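(* Let $A:[0,\infty)\to\mathbb{R}^{n\times n}$ be continuous and let $g:[0,\infty)\times\mathbb{R}^n\to\mathbb{R}^n$ satisfy $g(t,0)=0$ for all $t\ge 0$. Assume that the nominal linear system $\dot x=A(t)x$ is uniformly asymptotically stable, and let $c>0$, $\gamma>0$ be constants such that its state transition matrix satisfies $\|R(t,t_0)\|\le c\,e^{-\gamma(t-t_0)}$ for all $t\ge t_0\ge 0$. Suppose there exist $p\in[1,\infty]$, a function $\phi\in L^p([0,\infty),[0,\infty))$ and a nondecreasing function $\omega\in C^1([0,\infty),[0,\infty))$ with $\omega(0)=0$ such that $$\|g(t,x)\|\le\phi(t)\,\omega(\|x\|)\qquad\text{for all }(t,x)\in[0,\infty)\times\mathbb{R}^n.$$ Suppose that either (a) $\omega'(0)=0$; or (b) $\omega'(0)>0$ and one of the following holds: (i) $p=1$; (ii) $p\in(1,\infty]$ and there exists $\delta>0$ such that $$\|\phi\|_p<\frac{\left(\frac{p\,\gamma}{p-1}\right)^{1-1/p}}{2^{1/p}\,c\,\sup_{0\le s\le\delta}|\omega'(s)|},$$ where for $p=\infty$ the right-hand side is read as $\gamma/\big(c\,\sup_{0\le s\le\delta}|\omega'(s)|\big)$. Then the perturbed system $\dot x=A(t)x+g(t,x)$, $x(t_0)=x_0$, is uniformly exponentially stable.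
   Context: $\|\cdot\|$ denotes a fixed norm on $\mathbb{R}^n$ and also the induced operator norm on $\mathbb{R}^{n\times n}$. $R(t,t_0)$ is the state transition matrix of $\dot x=A(t)x$, i.e. $\partial_t R(t,t_0)=A(t)R(t,t_0)$, $R(t_0,t_0)=I$. The derivative of $\omega$ at $0$ is the right derivative. The linear system $\dot x=A(t)x$ is uniformly asymptotically stable if and only if there exist constants $c>0$, $\gamma>0$ such that $\|R(t,t_0)\|\le c\,e^{-\gamma(t-t_0)}$ for all $t\ge t_0\ge 0$. Solutions. For $t_0\ge0$ and $x_0\in\mathbb{R}^n$, a solution of $\dot x=A(t)x+g(t,x)$, $x(t_0)=x_0$ on $[t_0,T)$, $t_0<T\le\infty$, is a continuous function $x:[t_0,T)\to\mathbb{R}^n$ such that $s\mapsto g(s,x(s))$ is locally integrable on $[t_0,T)$ and $x(t)=x_0+\int_{t_0}^t\big(A(s)x(s)+g(s,x(s))\big)ds$ for all $t\in[t_0,T)$. It is non-continuable if it is not the restriction of a solution on $[t_0,T')$ with $T'>T$. It is assumed that $g$ is regular enough for the usual continuation property to hold: every non-continuable solution on $[t_0,T)$ with $T<\infty$ is unbounded on $[t_0,T)$ (this is automatic, for instance, if $g$ is continuous). The perturbed system (equivalently, its equilibrium point $x^*=0$) is uniformly exponentially stable if there exist constants $\delta_0>0$, $C>0$ and $\mu>0$ such that for all $t_0\ge0$ and all $x_0\in\mathbb{R}^n$ with $\|x_0\|\le\delta_0$, every non-continuable solution with $x(t_0)=x_0$ is defined on $[t_0,\infty)$ and satisfies $\|x(t)\|\le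 C\|x_0\|e^{-\mu(t-t_0)}$ for all $t\ge t_0$. *)

theory Defs
  imports "HOL-Analysis.Analysis" "HOL-Probability.Essential_Supremum"
begin

definition is_norm :: "(real^'n \<Rightarrow> real) \<Rightarrow> bool" where
  "is_norm N \<longleftrightarrow>
     (\<forall>x. 0 \<le> N x) \<and> (\<forall>x. N x = 0 \<longleftrightarrow> x = 0) \<and>
     (\<forall>a x. N (a *\<^sub>R x) = \<bar>a\<bar> * N x) \<and> (\<forall>x y. N (x + y) \<le> N x + N y)"

(* Same shape as the library's onorm, for an arbitrary norm N; at x = 0 the quotient is 0 / 0 = 0. *)
definition induced_norm :: "(real^'n \<Rightarrow> real) \<Rightarrow> real^'n^'n \<Rightarrow> real" where
  "induced_norm N M = (SUP x. N (M *v x) / N x)"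

(* Initial time and current time range over [0, \<infinity>), the domain of A; at time 0 the
   derivative is one-sided. *)
definition state_transition_matrix ::
    "(real \<Rightarrow> real^'n^'n) \<Rightarrow> (real \<Rightarrow> real \<Rightarrow> real^'n^'n) \<Rightarrow> bool" where
  "state_transition_matrix A R \<longleftrightarrow>
     (\<forall>t0\<ge>0. R t0 t0 = mat 1 \<and>
        (\<forall>t\<ge>0. ((\<lambda>s. R s t0) has_vector_derivative A t ** R t t0) (at t within {0..})))"

definition time_interval :: "real \<Rightarrow> ereal \<Rightarrow> real set" where
  "time_interval t0 T = {t. t0 \<le> t \<and> ereal t < T}"

(* Every compact subset of [t0, T) lies in some [t0, t] with t < T, so the third conjunct is local
   (Lebesgue) integrability of s \<mapsto> g(s, x(s)). *)
definition is_solution ::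
    "(real \<Rightarrow> real^'n^'n) \<Rightarrow> (real \<Rightarrow> real^'n \<Rightarrow> real^'n) \<Rightarrow> real \<Rightarrow> real^'n \<Rightarrow> ereal
      \<Rightarrow> (real \<Rightarrow> real^'n) \<Rightarrow> bool" where
  "is_solution A g t0 x0 T x \<longleftrightarrow>
     ereal t0 < T \<and>
     continuous_on (time_interval t0 T) x \<and>
     (\<forall>t\<in>time_interval t0 T. (\<lambda>s. g s (x s)) absolutely_integrable_on {t0..t}) \<and>
     (\<forall>t\<in>time_interval t0 T. x t = x0 + integral {t0..t} (\<lambda>s. A s *v x s + g s (x s)))"

definition noncontinuable_solution ::
    "(real \<Rightarrow> real^'n^'n) \<Rightarrow> (real \<Rightarrow> real^'n \<Rightarrow> real^'n) \<Rightarrow> real \<Rightarrow> real^'n \<Rightarrow> ereal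
      \<Rightarrow> (real \<Rightarrow> real^'n) \<Rightarrow> bool" where
  "noncontinuable_solution A g t0 x0 T x \<longleftrightarrow>
     is_solution A g t0 x0 T x \<and>
     \<not> (\<exists>T' y. T < T' \<and> is_solution A g t0 x0 T' y \<and> (\<forall>t\<in>time_interval t0 T. y t = x t))"

definition continuation_property ::
    "(real \<Rightarrow> real^'n^'n) \<Rightarrow> (real \<Rightarrow> real^'n \<Rightarrow> real^'n) \<Rightarrow> bool" where
  "continuation_property A g \<longleftrightarrow>
     (\<forall>t0 x0 T x. 0 \<le> t0 \<longrightarrow> T < \<infinity> \<longrightarrow> noncontinuable_solution A g t0 x0 T x
        \<longrightarrow> \<not> bounded (x ` time_interval t0 T))"

(* Uniform stability together with uniform attractivity of the origin, in terms of the solutions of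
   x' = A(t) x, all of which exist on [t0, \<infinity>). *)
definition uniformly_asymptotically_stable_linear ::
    "(real^'n \<Rightarrow> real) \<Rightarrow> (real \<Rightarrow> real^'n^'n) \<Rightarrow> bool" where
  "uniformly_asymptotically_stable_linear N A \<longleftrightarrow>
     (\<forall>\<epsilon>>0. \<exists>\<delta>>0. \<forall>t0\<ge>0. \<forall>x0 x. N x0 < \<delta> \<longrightarrow> is_solution A (\<lambda>_ _. 0) t0 x0 \<infinity> x
        \<longrightarrow> (\<forall>t\<ge>t0. N (x t) < \<epsilon>)) \<and>
     (\<exists>\<rho>>0. \<forall>\<epsilon>>0. \<exists>\<tau>>0. \<forall>t0\<ge>0. \<forall>x0 x. N x0 < \<rho> \<longrightarrow> is_solution A (\<lambda>_ _. 0) t0 x0 \<infinity> x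
        \<longrightarrow> (\<forall>t\<ge>t0 + \<tau>. N (x t) < \<epsilon>))"

definition uniformly_exponentially_stable ::
    "(real^'n \<Rightarrow> real) \<Rightarrow> (real \<Rightarrow> real^'n^'n) \<Rightarrow> (real \<Rightarrow> real^'n \<Rightarrow> real^'n) \<Rightarrow> bool" where
  "uniformly_exponentially_stable N A g \<longleftrightarrow>
     (\<exists>\<delta>0>0. \<exists>C>0. \<exists>\<mu>>0. \<forall>t0\<ge>0. \<forall>x0. N x0 \<le> \<delta>0 \<longrightarrow>
        (\<forall>T x. noncontinuable_solution A g t0 x0 T x \<longrightarrow>
           T = \<infinity> \<and> (\<forall>t\<ge>t0. N (x t) \<le> C * N x0 * exp (- \<mu> * (t - t0)))))"

definition in_Lp :: "ereal \<Rightarrow> (real \<Rightarrow> real) \<Rightarrow> bool" where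
  "in_Lp p f \<longleftrightarrow>
     f \<in> borel_measurable (lebesgue_on {0..}) \<and>
     (if p = \<infinity> then esssup (lebesgue_on {0..}) (\<lambda>t. ereal \<bar>f t\<bar>) < \<infinity>
      else integrable (lebesgue_on {0..}) (\<lambda>t. \<bar>f t\<bar> powr real_of_ereal p))"

(* Meaningful only for 1 \<le> p and in_Lp p f; otherwise the value is a default. *)
definition Lp_norm :: "ereal \<Rightarrow> (real \<Rightarrow> real) \<Rightarrow> real" where
  "Lp_norm p f =
     (if p = \<infinity> then real_of_ereal (esssup (lebesgue_on {0..}) (\<lambda>t. ereal \<bar>f t\<bar>))
      else (LINT t|lebesgue_on {0..}. \<bar>f t\<bar> powr real_of_ereal p) powr (1 / real_of_ereal p))"

(* The constant bounding the L^p norm of \<phi>; S stands for the supremum of |\<omega>'| on [0, \<delta>]. *)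
definition Lp_threshold :: "ereal \<Rightarrow> real \<Rightarrow> real \<Rightarrow> real \<Rightarrow> real" where
  "Lp_threshold p \<gamma> c S =
     (if p = \<infinity> then \<gamma> / (c * S)
      else let q = real_of_ereal p in
        (q * \<gamma> / (q - 1)) powr (1 - 1 / q) / (2 powr (1 / q) * c * S))"

end

(* By variation of constants, as long as N (x s) <= \<delta> the weighted norm u s = exp (\<gamma> (s - t0)) N (x s)
   satisfies u t <= c N x0 + c L \<integral> \<phi> u, where \<omega> s <= L s on [0, \<delta>], so Gronwall bounds N (x t) by
   c N x0 exp (c L \<integral> \<phi> - \<gamma> (t - t0)). The hypotheses on \<phi> give \<integral> \<phi> <= e (t - t0) + K with c L e < \<gamma>.
   Hence small solutions decay, never leave the \<delta>-ball, and so are global by the continuation property.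
   Variation of constants and Gronwall are needed with merely integrable data; there an inequality between
   increments up to e times an increasing function, on short intervals, takes the place of derivatives. *)
theory Submission
  imports Defs
begin

text \<open>The condition \<open>c * L * e < \<gamma>\<close> couples the slope \<open>L\<close> of
  \<open>\<omega>\<close> near 0 with the growth rate \<open>e\<close> of the integral of
  \<open>\<phi>\<close>, and the alternatives of the theorem are ways to meet it. If
  \<open>\<omega>' 0 = 0\<close>, \<open>L\<close> can be chosen small after \<open>e\<close>; if
  \<open>p\<close> is finite, \<open>e\<close> can be chosen small after \<open>L\<close>; if
  \<open>p = \<infinity>\<close> and \<open>\<omega>' 0 > 0\<close>, neither can be made small, and
  the threshold states that there is room. The additive constant \<open>K\<close> never affects the
  rate, only the factor in front of it. Variation of constants meets the obstacle that the
  transition matrix is known to be regular only in its current time. Continuity in the initial time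
  is recovered from the inverse matrix through Cramer's rule, and the formula is proved by showing
  that its right-hand side solves the same integral equation as the solution. Since \<open>N\<close>
  is an arbitrary norm, its comparison with the Euclidean norm makes the supremum in
  \<open>induced_norm\<close> finite and turns boundedness in \<open>N\<close> into the boundedness
  that the continuation property speaks of.\<close>

section \<open>Gronwall's inequality and the product rule for integrable data\<close>

text \<open>Summing the local estimate over a uniform partition of mesh below \<open>d\<close>
  telescopes on both sides, so the same estimate holds between \<open>a\<close> and \<open>b\<close>
  for every \<open>e\<close>; then \<open>e\<close> tends to 0. It replaces the statement that a
  function with nonpositive derivative does not increase.\<close>

lemma le_of_local_increments:
  fixes W H :: "real \<Rightarrow> real"
  assumes "a \<le> b"
    and loc: "\<And>e. e > 0 \<Longrightarrow> \<exists>d>0. \<forall>u v. a \<le> u \<and> u \<le> v \<and> v \<le> b \<and> v - u < d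
                \<longrightarrow> W v - W u \<le> e * (H v - H u)"
  shows "W b \<le> W a"
proof (rule ccontr)
  assume "\<not> W b \<le> W a"
  hence pos: "W b - W a > 0" by simp
  have *: "W b - W a \<le> e * (H b - H a)" if e: "e > 0" for e
  proof -
    obtain d where "d > 0" and d: "\<And>u v. a \<le> u \<Longrightarrow> u \<le> v \<Longrightarrow> v \<le> b \<Longrightarrow> v - u < d
                \<Longrightarrow> W v - W u \<le> e * (H v - H u)"
      using loc[OF e] by blast
    obtain n :: nat where n: "real n > (b - a) / d"
      using reals_Archimedean2 by blast
    have "n > 0" using n \<open>d > 0\<close> \<open>a \<le> b\<close>
      by (metis diff_ge_0_iff_ge divide_nonneg_pos gr0I not_le of_nat_0)
    define t where "t i = a + real i * ((b - a) / real n)" for i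
    have t0: "t 0 = a" and tn: "t n = b" using \<open>n > 0\<close> by (simp_all add: t_def)
    have step: "t (Suc i) - t i = (b - a) / real n" for i
      by (simp add: t_def distrib_right diff_divide_distrib[symmetric])
    have small: "(b - a) / real n < d" using n \<open>n > 0\<close> \<open>d > 0\<close> by (simp add: field_simps)
    have "W b - W a = (\<Sum>i<n. W (t (Suc i)) - W (t i))"
      by (simp add: sum_lessThan_telescope[of "\<lambda>i. W (t i)"] t0 tn)
    also have "\<dots> \<le> (\<Sum>i<n. e * (H (t (Suc i)) - H (t i)))"
    proof (rule sum_mono)
      fix i assume "i \<in> {..<n}"
      have "a \<le> t i" using \<open>a \<le> b\<close> by (simp add: t_def)
      moreover have "t i \<le> t (Suc i)" using step[of i] \<open>a \<le> b\<close>
        by (smt (verit) divide_nonneg_nonneg of_nat_0_le_iff)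
      moreover have "t (Suc i) \<le> b"
      proof -
        have "real (Suc i) * ((b - a) / real n) \<le> real n * ((b - a) / real n)"
          using \<open>i \<in> _\<close> \<open>a \<le> b\<close> by (intro mult_right_mono) auto
        thus ?thesis using \<open>n > 0\<close> by (simp add: t_def)
      qed
      ultimately show "W (t (Suc i)) - W (t i) \<le> e * (H (t (Suc i)) - H (t i))"
        using d step small by simp
    qed
    also have "\<dots> = e * (H b - H a)"
      by (simp add: sum_distrib_left[symmetric] sum_lessThan_telescope[of "\<lambda>i. H (t i)"] t0 tn)
    finally show ?thesis .
  qed
  have K: "H b - H a > 0" using *[of 1] pos by simp
  \<comment> \<open>This \<open>e\<close> is half the ratio of the two increments; it is positive
    because \<open>e = 1\<close> has already forced \<open>H b - H a > 0\<close>.\<close>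
  have "W b - W a \<le> (W b - W a) / (2 * (H b - H a)) * (H b - H a)"
    using pos K by (intro *) simp
  also have "\<dots> = (W b - W a) / 2"
    using K by (metis less_irrefl mult.commute nonzero_mult_divide_mult_cancel_right times_divide_eq_left)
  finally show False using pos by simp
qed

lemma absolutely_integrable_continuous_product:
  fixes X :: "real \<Rightarrow> 'a::euclidean_space" and y :: "real \<Rightarrow> 'b::euclidean_space"
    and prod :: "'a \<Rightarrow> 'b \<Rightarrow> 'c::euclidean_space"
  assumes "bounded_bilinear prod" "continuous_on {a..b} X" "y absolutely_integrable_on {a..b}"
  shows "(\<lambda>s. prod (X s) (y s)) absolutely_integrable_on {a..b}"
proof -
  have "bilinear prod" using assms(1) by (simp add: bilinear_conv_bounded_bilinear)
  moreover have "X \<in> borel_measurable (lebesgue_on {a..b})"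
    using assms(2) by (intro continuous_imp_measurable_on_sets_lebesgue) auto
  moreover have "bounded (X ` {a..b})"
    using assms(2) by (intro compact_imp_bounded compact_continuous_image) auto
  ultimately show ?thesis
    using absolutely_integrable_bounded_measurable_product[of prod X "{a..b}" y] assms(3) by simp
qed

text \<open>Formally \<open>U' = k u \<le> k U\<close> for the right-hand side \<open>U\<close> of
  the hypothesis, so \<open>U * exp (- K)\<close> does not increase, where \<open>K\<close> is the
  integral of \<open>k\<close>. As \<open>k\<close> is only integrable, this is shown on increments:
  their first-order parts cancel, and what remains is at most
  \<open>(K t - K s) * (U t - U s)\<close>, which uniform continuity of \<open>U\<close> makes small
  relative to \<open>K t - K s\<close>.\<close>

lemma gronwall_integrable:
  fixes u k :: "real \<Rightarrow> real"
  assumes "a \<le> b" and k: "k absolutely_integrable_on {a..b}"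
    and k0: "\<And>s. s \<in> {a..b} \<Longrightarrow> 0 \<le> k s"
    and u: "continuous_on {a..b} u" and u0: "\<And>s. s \<in> {a..b} \<Longrightarrow> 0 \<le> u s"
    and bound: "\<And>t. t \<in> {a..b} \<Longrightarrow> u t \<le> m + integral {a..t} (\<lambda>s. k s * u s)"
  shows "u b \<le> m * exp (integral {a..b} k)"
proof -
  define U where "U t = m + integral {a..t} (\<lambda>s. k s * u s)" for t
  define K where "K t = integral {a..t} k" for t
  have ki: "k integrable_on {a..b}" using k set_lebesgue_integral_eq_integral(1) by blast
  have "(\<lambda>s. u s * k s) absolutely_integrable_on {a..b}"
    using bounded_bilinear_mult u k by (rule absolutely_integrable_continuous_product)
  hence kui: "(\<lambda>s. k s * u s) integrable_on {a..b}"
    by (simp add: mult.commute set_lebesgue_integral_eq_integral(1))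
  have Udiff: "U t - U s = integral {s..t} (\<lambda>s. k s * u s)" if "a \<le> s" "s \<le> t" "t \<le> b" for s t
    using Henstock_Kurzweil_Integration.integral_combine[of a s t "\<lambda>s. k s * u s"] that
      integrable_on_subinterval[OF kui, of a t]
    by (simp add: U_def)
  have Kdiff: "K t - K s = integral {s..t} k" if "a \<le> s" "s \<le> t" "t \<le> b" for s t
    using Henstock_Kurzweil_Integration.integral_combine[of a s t k] that
      integrable_on_subinterval[OF ki, of a t]
    by (simp add: K_def)
  have Umono: "U s \<le> U t" if "a \<le> s" "s \<le> t" "t \<le> b" for s t
  proof -
    have "0 \<le> integral {s..t} (\<lambda>s. k s * u s)"
      using that k0 u0 by (intro integral_nonneg integrable_on_subinterval[OF kui]) auto
    thus ?thesis using Udiff[OF that] by simp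
  qed
  have Kmono: "K s \<le> K t" if "a \<le> s" "s \<le> t" "t \<le> b" for s t
  proof -
    have "0 \<le> integral {s..t} k"
      using that k0 by (intro integral_nonneg integrable_on_subinterval[OF ki]) auto
    thus ?thesis using Kdiff[OF that] by simp
  qed
  have Ka: "K a = 0" and Ua: "U a = m" by (simp_all add: K_def U_def)
  have "continuous_on {a..b} U"
    unfolding U_def by (intro continuous_intros indefinite_integral_continuous_1 kui)
  hence Uunif: "uniformly_continuous_on {a..b} U"
    by (rule compact_uniformly_continuous) simp
  have "U b * exp (- K b) \<le> U a * exp (- K a)"
  proof (rule le_of_local_increments[where H = K, OF \<open>a \<le> b\<close>])
    fix e :: real assume "e > 0"
    then obtain d where "d > 0" and d: "\<And>s t. s \<in> {a..b} \<Longrightarrow> t \<in> {a..b} \<Longrightarrow> dist t s < d \<Longrightarrow> dist (U t) (U s) < e"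
      using Uunif unfolding uniformly_continuous_on_def by metis
    have "U t * exp (- K t) - U s * exp (- K s) \<le> e * (K t - K s)"
      if st: "a \<le> s" "s \<le> t" "t \<le> b" "t - s < d" for s t
    proof -
      \<comment> \<open>\<open>U\<close> is nondecreasing, so its value at the right end dominates
        \<open>u\<close> on the whole subinterval.\<close>
      have "integral {s..t} (\<lambda>r. k r * u r) \<le> integral {s..t} (\<lambda>r. k r * U t)"
      proof (rule integral_le)
        show "(\<lambda>r. k r * u r) integrable_on {s..t}"
          using st by (intro integrable_on_subinterval[OF kui]) auto
        show "(\<lambda>r. k r * U t) integrable_on {s..t}"
          using st integrable_on_subinterval[OF ki] by (intro integrable_on_mult_left) auto
        fix r assume r: "r \<in> {s..t}"
        have "u r \<le> U r" using bound[of r] st r by (simp add: U_def)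
        also have "\<dots> \<le> U t" using Umono[of r t] st r by simp
        finally show "k r * u r \<le> k r * U t" using k0[of r] st r by (intro mult_left_mono) auto
      qed
      hence 1: "U t - U s \<le> (K t - K s) * U t"
        using Udiff[of s t] Kdiff[of s t] st by simp
      have Us: "0 \<le> U s" using bound[of s] u0[of s] st by (auto simp: U_def)
      have "exp (- K s) = exp (- K t) * exp (K t - K s)" by (simp add: exp_add[symmetric])
      also have "\<dots> \<ge> exp (- K t) * (1 + (K t - K s))"
        by (intro mult_left_mono exp_ge_add_one_self) auto
      finally have 2: "U s * (exp (- K t) * (1 + (K t - K s))) \<le> U s * exp (- K s)"
        using Us by (intro mult_left_mono)
      have "U t * exp (- K t) - U s * exp (- K s)
            \<le> exp (- K t) * (U t - U s) - U s * exp (- K t) * (K t - K s)"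
        using 2 by (simp add: algebra_simps)
      also have "\<dots> \<le> exp (- K t) * ((K t - K s) * U t) - U s * exp (- K t) * (K t - K s)"
        using 1 by (intro diff_right_mono mult_left_mono) auto
      also have "\<dots> = exp (- K t) * ((K t - K s) * (U t - U s))"
        by (simp add: algebra_simps)
      \<comment> \<open>The exponential factor is at most 1 since
        \<open>K t \<ge> K a = 0\<close>.\<close>
      also have "\<dots> \<le> 1 * ((K t - K s) * (U t - U s))"
        using Kmono[of s t] Umono[of s t] Kmono[of a t] Ka st by (intro mult_right_mono) auto
      also have "\<dots> \<le> (K t - K s) * e"
        using d[of s t] st Kmono[of s t] by (simp add: dist_real_def mult_left_mono)
      finally show ?thesis by (simp add: mult.commute)
    qed
    thus "\<exists>d>0. \<forall>s t. a \<le> s \<and> s \<le> t \<and> t \<le> b \<and> t - s < d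
        \<longrightarrow> U t * exp (- K t) - U s * exp (- K s) \<le> e * (K t - K s)"
      using \<open>d > 0\<close> by blast
  qed
  hence "U b \<le> m * exp (K b)"
    by (simp add: Ka Ua exp_minus field_simps)
  moreover have "u b \<le> U b" using bound[of b] \<open>a \<le> b\<close> by (simp add: U_def)
  ultimately show ?thesis by (simp add: K_def)
qed

text \<open>The defect \<open>D\<close> between the two sides, as a function of the upper limit, is
  constant: on a short interval both factors vary by at most \<open>e / B\<close>, so the increment
  of \<open>D\<close> is at most \<open>e\<close> times the integral of
  \<open>norm (x s) + norm (y s)\<close>. The division by \<open>B\<close> cancels the bound of the
  bilinear map.\<close>

lemma integral_by_parts_absolutely_continuous:
  fixes X x :: "real \<Rightarrow> 'a::euclidean_space" and Y y :: "real \<Rightarrow> 'b::euclidean_space"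
    and prod :: "'a \<Rightarrow> 'b \<Rightarrow> 'c::euclidean_space"
  assumes bil: "bounded_bilinear prod" and "a \<le> b"
    and x: "x absolutely_integrable_on {a..b}" and y: "y absolutely_integrable_on {a..b}"
    and X: "\<And>t. t \<in> {a..b} \<Longrightarrow> X t = X a + integral {a..t} x"
    and Y: "\<And>t. t \<in> {a..b} \<Longrightarrow> Y t = Y a + integral {a..t} y"
  shows "integral {a..b} (\<lambda>s. prod (X s) (y s) + prod (x s) (Y s)) = prod (X b) (Y b) - prod (X a) (Y a)"
proof -
  interpret bounded_bilinear prod by (fact bil)
  note integrable = set_lebesgue_integral_eq_integral(1)
  have xi: "x integrable_on {a..b}" and yi: "y integrable_on {a..b}" using x y integrable by blast+
  have Xc: "continuous_on {a..b} X"
  proof -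
    have "continuous_on {a..b} (\<lambda>t. X a + integral {a..t} x)"
      by (intro continuous_intros indefinite_integral_continuous_1 xi)
    thus ?thesis by (subst continuous_on_cong[OF refl X])
  qed
  have Yc: "continuous_on {a..b} Y"
  proof -
    have "continuous_on {a..b} (\<lambda>t. Y a + integral {a..t} y)"
      by (intro continuous_intros indefinite_integral_continuous_1 yi)
    thus ?thesis by (subst continuous_on_cong[OF refl Y])
  qed
  have Xy: "(\<lambda>s. prod (X s) (y s)) integrable_on {a..b}"
    by (intro integrable absolutely_integrable_continuous_product[OF bil] Xc y)
  have "(\<lambda>s. prod (x s) (Y s)) absolutely_integrable_on {a..b}"
    by (rule absolutely_integrable_continuous_product[OF flip Yc x])
  hence xY: "(\<lambda>s. prod (x s) (Y s)) integrable_on {a..b}" by (rule integrable)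
  define P where "P s = prod (X s) (y s) + prod (x s) (Y s)" for s
  define D where "D t = integral {a..t} P - prod (X t) (Y t)" for t
  define h where "h s = norm (x s) + norm (y s)" for s
  define H where "H t = integral {a..t} h" for t
  have Pi: "P integrable_on {a..b}" unfolding P_def by (intro integrable_add Xy xY)
  have hi: "h integrable_on {a..b}" unfolding h_def
    by (intro integrable_add integrable absolutely_integrable_norm[unfolded o_def] x y)
  have sub: "f integrable_on {s..t}" if "f integrable_on {a..b}" "a \<le> s" "s \<le> t" "t \<le> b"
    for f :: "real \<Rightarrow> 'd::banach" and s t
    using that by (intro integrable_on_subinterval[OF that(1)]) auto
  have comb: "integral {a..t} f - integral {a..s} f = integral {s..t} f"
    if "f integrable_on {a..b}" "a \<le> s" "s \<le> t" "t \<le> b" for f :: "real \<Rightarrow> 'd::banach" and s t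
    using Henstock_Kurzweil_Integration.integral_combine[of a s t f] that sub[of f a t]
    by (simp add: algebra_simps)
  obtain B where "B > 0" and B: "\<And>p q. norm (prod p q) \<le> norm p * norm q * B"
    using pos_bounded by blast
  \<comment> \<open>The increment lemma compares real functions, so it is applied to the distance of
    \<open>D\<close> from its initial value.\<close>
  have "norm (D b - D a) \<le> norm (D a - D a)"
  proof (rule le_of_local_increments[where H = H, OF \<open>a \<le> b\<close>])
    fix e :: real assume "e > 0"
    hence eB: "e / B > 0" using \<open>B > 0\<close> by simp
    have "uniformly_continuous_on {a..b} X" "uniformly_continuous_on {a..b} Y"
      using Xc Yc by (auto intro: compact_uniformly_continuous)
    then obtain d1 d2 where "d1 > 0" "d2 > 0"
      and d1: "\<And>s t. s \<in> {a..b} \<Longrightarrow> t \<in> {a..b} \<Longrightarrow> dist t s < d1 \<Longrightarrow> dist (X t) (X s) < e / B"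
      and d2: "\<And>s t. s \<in> {a..b} \<Longrightarrow> t \<in> {a..b} \<Longrightarrow> dist t s < d2 \<Longrightarrow> dist (Y t) (Y s) < e / B"
      using eB unfolding uniformly_continuous_on_def by metis
    have "norm (D t - D a) - norm (D s - D a) \<le> e * (H t - H s)"
      if st: "a \<le> s" "s \<le> t" "t \<le> b" "t - s < min d1 d2" for s t
    proof -
      have Xd: "integral {s..t} x = X t - X s" and Yd: "integral {s..t} y = Y t - Y s"
        using X[of s] X[of t] Y[of s] Y[of t] comb[OF xi, of s t] comb[OF yi, of s t] st by auto
      \<comment> \<open>\<open>X\<close> is frozen at the right end and \<open>Y\<close> at the left
        end: with this choice the two frozen integrals add up exactly to
        \<open>prod (X t) (Y t) - prod (X s) (Y s)\<close>, and no second-order term is left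
        over.\<close>
      have i1: "((\<lambda>r. prod (X t) (y r)) has_integral prod (X t) (Y t - Y s)) {s..t}"
        using has_integral_linear[OF integrable_integral[OF sub[OF yi]] bounded_linear_right, of s t "X t"] st
        by (simp add: Yd o_def)
      have i2: "((\<lambda>r. prod (x r) (Y s)) has_integral prod (X t - X s) (Y s)) {s..t}"
        using has_integral_linear[OF integrable_integral[OF sub[OF xi]] bounded_linear_left, of s t "Y s"] st
        by (simp add: Xd o_def)
      have "((\<lambda>r. P r - (prod (X t) (y r) + prod (x r) (Y s))) has_integral
              integral {s..t} P - (prod (X t) (Y t - Y s) + prod (X t - X s) (Y s))) {s..t}"
        using st by (intro has_integral_diff has_integral_add i1 i2 integrable_integral sub[OF Pi])
      moreover have "integral {s..t} P - (prod (X t) (Y t - Y s) + prod (X t - X s) (Y s)) = D t - D s"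
        using comb[OF Pi, of s t] st by (simp add: D_def diff_left diff_right)
      moreover have "(\<lambda>r. P r - (prod (X t) (y r) + prod (x r) (Y s)))
          = (\<lambda>r. prod (X r - X t) (y r) + prod (x r) (Y r - Y s))"
        by (auto simp: P_def diff_left diff_right)
      ultimately have D: "((\<lambda>r. prod (X r - X t) (y r) + prod (x r) (Y r - Y s)) has_integral D t - D s) {s..t}"
        by simp
      have "norm (D t - D s) \<le> integral {s..t} (\<lambda>r. e * h r)"
        unfolding integral_unique[OF D, symmetric]
      proof (rule integral_norm_bound_integral)
        show "(\<lambda>r. prod (X r - X t) (y r) + prod (x r) (Y r - Y s)) integrable_on {s..t}"
          using D by blast
        show "(\<lambda>r. e * h r) integrable_on {s..t}"
          using st by (intro integrable_on_mult_right sub[OF hi])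
        fix r assume r: "r \<in> {s..t}"
        have "norm (X r - X t) \<le> e / B" "norm (Y r - Y s) \<le> e / B"
          using d1[of t r] d2[of s r] r st by (auto simp: dist_norm norm_minus_commute)
        hence "norm (X r - X t) * norm (y r) * B \<le> e / B * norm (y r) * B"
          "norm (x r) * norm (Y r - Y s) * B \<le> norm (x r) * (e / B) * B"
          using \<open>B > 0\<close> by (intro mult_right_mono mult_left_mono; simp)+
        hence "norm (prod (X r - X t) (y r)) \<le> e * norm (y r)" "norm (prod (x r) (Y r - Y s)) \<le> e * norm (x r)"
          using B[of "X r - X t" "y r"] B[of "x r" "Y r - Y s"] \<open>B > 0\<close> by (auto simp: mult.commute)
        thus "norm (prod (X r - X t) (y r) + prod (x r) (Y r - Y s)) \<le> e * h r"
          using norm_triangle_ineq[of "prod (X r - X t) (y r)" "prod (x r) (Y r - Y s)"]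
          by (simp add: h_def distrib_left)
      qed
      also have "\<dots> = e * (H t - H s)"
        using comb[OF hi, of s t] st by (simp add: H_def)
      finally show ?thesis using norm_triangle_ineq[of "D t - D s" "D s - D a"] by simp
    qed
    thus "\<exists>d>0. \<forall>s t. a \<le> s \<and> s \<le> t \<and> t \<le> b \<and> t - s < d
        \<longrightarrow> norm (D t - D a) - norm (D s - D a) \<le> e * (H t - H s)"
      using \<open>d1 > 0\<close> \<open>d2 > 0\<close> by (intro exI[of _ "min d1 d2"]) auto
  qed
  hence "D b = D a" by simp
  thus ?thesis unfolding D_def P_def by (simp add: algebra_simps)
qed

lemma bounded_bilinear_matrix_vector_mult:
  "bounded_bilinear ((*v) :: real^'n^'m \<Rightarrow> real^'n \<Rightarrow> real^'m)"
  unfolding bilinear_conv_bounded_bilinear[symmetric] bilinear_def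
  by (auto intro!: linearI simp: matrix_vector_mult_add_rdistrib scaleR_matrix_vector_assoc
      matrix_vector_right_distrib matrix_vector_mult_scaleR)

text \<open>Gronwall's inequality for \<open>norm (w t)\<close> with \<open>m = 0\<close>. It serves
  as the uniqueness principle: the difference of two solutions with the same initial value and the
  same forcing satisfies this equation.\<close>

lemma linear_integral_equation_unique:
  fixes A :: "real \<Rightarrow> real^'n^'n" and w :: "real \<Rightarrow> real^'n"
  assumes "a \<le> b" and A: "continuous_on {a..b} A" and w: "continuous_on {a..b} w"
    and eq: "\<And>t. t \<in> {a..b} \<Longrightarrow> w t = integral {a..t} (\<lambda>s. A s *v w s)"
  shows "w b = 0"
proof -
  interpret bounded_bilinear "(*v) :: real^'n^'n \<Rightarrow> real^'n \<Rightarrow> real^'n"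
    by (rule bounded_bilinear_matrix_vector_mult)
  obtain B where "B > 0" and B: "\<And>(p :: real^'n^'n) q. norm (p *v q) \<le> norm p * norm q * B"
    using pos_bounded by blast
  have k: "continuous_on {a..b} (\<lambda>s. norm (A s) * B)"
    by (intro continuous_intros A)
  have "norm (w b) \<le> 0 * exp (integral {a..b} (\<lambda>s. norm (A s) * B))"
  proof (rule gronwall_integrable)
    show "(\<lambda>s. norm (A s) * B) absolutely_integrable_on {a..b}"
      by (intro absolutely_integrable_continuous_real k)
    fix t assume t: "t \<in> {a..b}"
    hence sub: "{a..t} \<subseteq> {a..b}" by auto
    have "norm (w t) \<le> integral {a..t} (\<lambda>s. norm (A s) * B * norm (w s))"
      unfolding eq[OF t]
    proof (rule integral_norm_bound_integral)
      show "(\<lambda>s. A s *v w s) integrable_on {a..t}"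
        by (intro integrable_continuous_real continuous_on continuous_on_subset[OF A sub] continuous_on_subset[OF w sub])
      show "(\<lambda>s. norm (A s) * B * norm (w s)) integrable_on {a..t}"
        by (intro integrable_continuous_real continuous_intros continuous_on_subset[OF A sub] continuous_on_subset[OF w sub])
      show "norm (A s *v w s) \<le> norm (A s) * B * norm (w s)" for s
        using B[of "A s" "w s"] by (simp add: mult_ac)
    qed
    thus "norm (w t) \<le> 0 + integral {a..t} (\<lambda>s. norm (A s) * B * norm (w s))" by simp
  qed (use \<open>a \<le> b\<close> \<open>B > 0\<close> w in \<open>auto intro: continuous_intros\<close>)
  thus ?thesis by simp
qed

section \<open>Arbitrary norms: equivalence, induced norm, integrals\<close>

lemma is_norm_zero: "is_norm N \<Longrightarrow> N 0 = 0"
  unfolding is_norm_def by blast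

lemma is_norm_sum_le:
  assumes "is_norm N"
  shows "N (sum f I) \<le> (\<Sum>i\<in>I. N (f i))"
proof (induction I rule: infinite_finite_induct)
  case (insert i I)
  moreover have "N (f i + sum f I) \<le> N (f i) + N (sum f I)"
    using assms by (simp add: is_norm_def)
  ultimately show ?case by simp
qed (use is_norm_zero[OF assms] in auto)

lemma is_norm_upper_bound:
  fixes N :: "real^'n \<Rightarrow> real"
  assumes "is_norm N"
  obtains K where "K > 0" "\<And>x. N x \<le> K * norm x"
proof
  have pos: "0 \<le> N x" for x using assms by (simp add: is_norm_def)
  define K where "K = (\<Sum>b\<in>Basis. N (b :: real^'n)) + 1"
  show "K > 0" unfolding K_def using sum_nonneg[of Basis N] pos by (smt (verit))
  show "N x \<le> K * norm x" for x
  proof -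
    have "N x = N (\<Sum>b\<in>Basis. (x \<bullet> b) *\<^sub>R b)" by (simp add: euclidean_representation)
    also have "\<dots> \<le> (\<Sum>b\<in>Basis. N ((x \<bullet> b) *\<^sub>R b))" by (rule is_norm_sum_le[OF assms])
    also have "\<dots> \<le> (\<Sum>b\<in>Basis. N b * norm x)"
    proof (rule sum_mono)
      fix b :: "real^'n" assume "b \<in> Basis"
      have "N ((x \<bullet> b) *\<^sub>R b) = \<bar>x \<bullet> b\<bar> * N b" using assms by (simp add: is_norm_def)
      also have "\<dots> \<le> norm x * N b"
        using Basis_le_norm[OF \<open>b \<in> Basis\<close>] pos by (intro mult_right_mono) auto
      finally show "N ((x \<bullet> b) *\<^sub>R b) \<le> N b * norm x" by (simp add: mult.commute)
    qed
    also have "\<dots> \<le> K * norm x" by (simp add: K_def sum_distrib_right distrib_right)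
    finally show ?thesis .
  qed
qed

lemma is_norm_continuous_on:
  fixes N :: "real^'n \<Rightarrow> real"
  assumes "is_norm N"
  shows "continuous_on S N"
proof -
  obtain K where K: "K > 0" "\<And>x. N x \<le> K * norm x" using is_norm_upper_bound[OF assms] by blast
  have tri: "N x \<le> N y + K * dist x y" for x y
  proof -
    have "N (y + (x - y)) \<le> N y + N (x - y)" using assms unfolding is_norm_def by blast
    thus ?thesis using K(2)[of "x - y"] by (simp add: dist_norm)
  qed
  have "dist (N x) (N y) \<le> K * dist x y" for x y
    using tri[of x y] tri[of y x] by (simp add: dist_real_def dist_commute)
  hence "K-lipschitz_on S N" using K(1) by (intro lipschitz_onI) auto
  thus ?thesis by (rule lipschitz_on_continuous_on)
qed

text \<open>The constant is the minimum of the continuous function \<open>N\<close> on the compact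
  Euclidean unit sphere; homogeneity does the rest.\<close>

lemma is_norm_lower_bound:
  fixes N :: "real^'n \<Rightarrow> real"
  assumes "is_norm N"
  obtains m where "m > 0" "\<And>x. m * norm x \<le> N x"
proof -
  have "axis undefined 1 \<in> sphere (0 :: real^'n) 1" by (simp add: norm_axis_1)
  hence "sphere (0 :: real^'n) 1 \<noteq> {}" by blast
  then obtain x0 where x0: "x0 \<in> sphere 0 1" "\<And>x. x \<in> sphere 0 1 \<Longrightarrow> N x0 \<le> N x"
    using continuous_attains_inf[OF compact_sphere _ is_norm_continuous_on[OF assms]] by metis
  have "N x0 > 0" using assms x0(1) unfolding is_norm_def by (smt (verit) mem_sphere_0 norm_zero)
  moreover have "N x0 * norm x \<le> N x" for x
  proof (cases "x = 0")
    case False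
    have "N x0 \<le> N (inverse (norm x) *\<^sub>R x)" using False by (intro x0) simp
    also have "\<dots> = inverse (norm x) * N x" using assms by (simp add: is_norm_def)
    finally show ?thesis using False by (simp add: field_simps)
  qed (use assms in \<open>simp add: is_norm_def\<close>)
  ultimately show ?thesis using that by blast
qed

text \<open>A real supremum bounds its members only if they are bounded above. Equivalence of norms
  supplies the bound \<open>K * onorm / m\<close> for the quotients.\<close>

lemma induced_norm_bound:
  fixes M :: "real^'n^'n"
  assumes N: "is_norm N"
  shows "N (M *v x) \<le> induced_norm N M * N x"
proof (cases "x = 0")
  case False
  have pos: "N y > 0" if "y \<noteq> 0" for y using N that unfolding is_norm_def by (metis less_eq_real_def)
  have N0: "N 0 = 0" using N by (simp add: is_norm_def)
  obtain K where K: "K > 0" "\<And>x. N x \<le> K * norm x" using is_norm_upper_bound[OF N] by blast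
  obtain m where m: "m > 0" "\<And>x. m * norm x \<le> N x" using is_norm_lower_bound[OF N] by blast
  have "N (M *v y) / N y \<le> K * onorm ((*v) M) / m" for y
  proof (cases "y = 0")
    case False
    have "m * N (M *v y) \<le> m * (K * norm (M *v y))" using K m by simp
    also have "\<dots> \<le> m * (K * (onorm ((*v) M) * norm y))"
      using K m by (intro mult_left_mono onorm) auto
    also have "\<dots> = K * onorm ((*v) M) * (m * norm y)" by simp
    also have "\<dots> \<le> K * onorm ((*v) M) * N y"
      using K m by (intro mult_left_mono mult_nonneg_nonneg onorm_pos_le) auto
    finally show ?thesis using m pos[OF False] by (simp add: field_simps)
  qed (use K m in \<open>simp add: N0 onorm_pos_le\<close>)
  hence "bdd_above (range (\<lambda>y. N (M *v y) / N y))" by (intro bdd_aboveI) auto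
  hence "N (M *v x) / N x \<le> induced_norm N M"
    unfolding induced_norm_def by (intro cSUP_upper) auto
  thus ?thesis using pos[OF False] by (simp add: field_simps)
qed (simp add: is_norm_zero[OF N])

lemma is_norm_absolutely_integrable:
  fixes f :: "real \<Rightarrow> real^'n"
  assumes N: "is_norm N" and f: "f absolutely_integrable_on {a..b}"
  shows "(\<lambda>s. N (f s)) absolutely_integrable_on {a..b}"
proof -
  obtain K where K: "K > 0" "\<And>x. N x \<le> K * norm x" using is_norm_upper_bound[OF N] by blast
  show ?thesis
  proof (rule measurable_bounded_by_integrable_imp_absolutely_integrable)
    have "N \<in> borel_measurable borel"
      using is_norm_continuous_on[OF N] by (rule borel_measurable_continuous_onI)
    thus "(\<lambda>s. N (f s)) \<in> borel_measurable (lebesgue_on {a..b})"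
      using absolutely_integrable_imp_borel_measurable[OF f] by simp
    show "(\<lambda>s. K * norm (f s)) integrable_on {a..b}"
      using f by (intro integrable_on_mult_right) (simp add: absolutely_integrable_on_def)
    show "norm (N (f s)) \<le> K * norm (f s)" for s
      using K N by (simp add: is_norm_def)
  qed auto
qed

text \<open>For Riemann sums this is the finite triangle inequality, as the weights are nonnegative.
  It passes to the limit along tagged divisions because \<open>N\<close> is continuous and
  \<open>N\<close> of the integrand is itself integrable.\<close>

lemma is_norm_integral_le:
  fixes f :: "real \<Rightarrow> real^'n"
  assumes N: "is_norm N" and f: "f absolutely_integrable_on {a..b}"
  shows "N (integral {a..b} f) \<le> integral {a..b} (\<lambda>s. N (f s))"
proof (rule tendsto_le)
  have "((\<lambda>p. \<Sum>(x,k)\<in>p. measure lborel k *\<^sub>R f x) \<longlongrightarrow> integral {a..b} f) (division_filter (cbox a b))"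
    unfolding has_integral_cbox[symmetric]
    using f by (simp add: integrable_integral set_lebesgue_integral_eq_integral(1))
  thus "((\<lambda>p. N (\<Sum>(x,k)\<in>p. measure lborel k *\<^sub>R f x)) \<longlongrightarrow> N (integral {a..b} f)) (division_filter (cbox a b))"
    by (rule continuous_on_tendsto_compose[OF is_norm_continuous_on[OF N, of UNIV]]) auto
  show "((\<lambda>p. \<Sum>(x,k)\<in>p. measure lborel k *\<^sub>R N (f x)) \<longlongrightarrow> integral {a..b} (\<lambda>s. N (f s))) (division_filter (cbox a b))"
    unfolding has_integral_cbox[symmetric]
    using is_norm_absolutely_integrable[OF N f]
    by (simp add: integrable_integral set_lebesgue_integral_eq_integral(1))
  have scale: "N (measure lborel k *\<^sub>R f x) = measure lborel k * N (f x)" for k :: "real set" and x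
    using N by (simp add: is_norm_def)
  have "N (\<Sum>(x,k)\<in>p. measure lborel k *\<^sub>R f x) \<le> (\<Sum>(x,k)\<in>p. measure lborel k *\<^sub>R N (f x))"
    for p :: "(real \<times> real set) set"
    using is_norm_sum_le[OF N, of "\<lambda>(x,k). measure lborel k *\<^sub>R f x" p] by (simp add: split_def scale)
  thus "\<forall>\<^sub>F p in division_filter (cbox a b). N (\<Sum>(x,k)\<in>p. measure lborel k *\<^sub>R f x) \<le> (\<Sum>(x,k)\<in>p. measure lborel k *\<^sub>R N (f x))"
    by simp
qed (rule division_filter_not_empty)

section \<open>The transition matrix and variation of constants\<close>

lemma continuous_on_det:
  fixes M :: "'a::topological_space \<Rightarrow> real^'n^'n"
  assumes "\<And>i j. continuous_on S (\<lambda>s. M s $ i $ j)"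
  shows "continuous_on S (\<lambda>s. det (M s))"
  unfolding det_def by (intro continuous_on_sum continuous_on_mult continuous_on_const continuous_on_prod assms)

lemma transition_matrix_derivative:
  assumes R: "state_transition_matrix A R" and "0 \<le> t0" "0 \<le> a" "t \<in> {a..b}"
  shows "((\<lambda>s. R s t0) has_vector_derivative A t ** R t t0) (at t within {a..b})"
proof (rule has_vector_derivative_within_subset)
  show "((\<lambda>s. R s t0) has_vector_derivative A t ** R t t0) (at t within {0..})"
    using assms by (simp add: state_transition_matrix_def)
qed (use \<open>0 \<le> a\<close> in auto)

lemma transition_matrix_continuous:
  assumes R: "state_transition_matrix A R" and "0 \<le> t0" "0 \<le> a"
  shows "continuous_on {a..b} (\<lambda>s. R s t0)"
  unfolding continuous_on_eq_continuous_within
  by (intro ballI has_vector_derivative_continuous[OF transition_matrix_derivative[OF assms]])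

text \<open>As functions of \<open>t\<close>, both sides solve the linear equation and agree at
  \<open>t = a\<close>, so uniqueness applies. No order between \<open>a\<close> and
  \<open>s\<close> is assumed: for \<open>a < s\<close> the matrix \<open>R a s\<close> leads
  backward in time, which yields the inverse below.\<close>

lemma transition_matrix_compose:
  fixes A :: "real \<Rightarrow> real^'n^'n"
  assumes A: "continuous_on {0..} A" and R: "state_transition_matrix A R"
    and "0 \<le> a" "a \<le> t" "0 \<le> s"
  shows "R t a *v (R a s *v y) = R t s *v y"
proof -
  interpret mv: bounded_bilinear "(*v) :: real^'n^'n \<Rightarrow> real^'n \<Rightarrow> real^'n"
    by (rule bounded_bilinear_matrix_vector_mult)
  define w where "w r = R r a *v (R a s *v y) - R r s *v y" for r
  have "w t = 0"
  proof (rule linear_integral_equation_unique[OF \<open>a \<le> t\<close>])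
    show "continuous_on {a..t} A" using A \<open>0 \<le> a\<close> by (auto intro: continuous_on_subset)
    show "continuous_on {a..t} w"
      unfolding w_def by (intro continuous_intros mv.continuous_on transition_matrix_continuous[OF R] assms)
    fix r assume r: "r \<in> {a..t}"
    have "((\<lambda>q. A q *v w q) has_integral w r - w a) {a..r}"
    proof (rule fundamental_theorem_of_calculus)
      fix q assume q: "q \<in> {a..r}"
      have "((\<lambda>q. R q t0 *v v) has_vector_derivative (A q ** R q t0) *v v) (at q within {a..r})"
        if "0 \<le> t0" for t0 v
        using bounded_linear.has_vector_derivative[OF mv.bounded_linear_left
            transition_matrix_derivative[OF R that \<open>0 \<le> a\<close> q]] .
      from has_vector_derivative_diff[OF this[OF \<open>0 \<le> a\<close>, of "R a s *v y"] this[OF \<open>0 \<le> s\<close>, of y]]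
      have "(w has_vector_derivative (A q ** R q a) *v (R a s *v y) - (A q ** R q s) *v y) (at q within {a..r})"
        by (simp add: w_def[abs_def])
      thus "(w has_vector_derivative A q *v w q) (at q within {a..r})"
        by (simp add: w_def matrix_vector_mult_diff_distrib matrix_vector_mul_assoc matrix_mul_assoc)
    qed (use r in auto)
    moreover have "w a = 0" using R \<open>0 \<le> a\<close> by (simp add: w_def state_transition_matrix_def)
    ultimately show "w r = integral {a..r} (\<lambda>q. A q *v w q)" by (simp add: integral_unique)
  qed
  thus ?thesis by (simp add: w_def)
qed

lemma transition_matrix_inverse:
  assumes "continuous_on {0..} A" and R: "state_transition_matrix A R" and "0 \<le> a" "a \<le> s"
  shows "R s a ** R a s = mat 1"
proof -
  have "R s s = mat 1" using R assms by (simp add: state_transition_matrix_def)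
  thus ?thesis
    using transition_matrix_compose[OF assms, of s] assms
    by (simp add: matrix_eq matrix_vector_mul_assoc)
qed

text \<open>The definition of \<open>R\<close> says nothing about regularity in the initial time.
  But \<open>R a s\<close> inverts \<open>R s a\<close>, which is continuous in \<open>s\<close>,
  and Cramer's rule writes the entries of the inverse as quotients of determinants of continuous
  entries.\<close>

lemma transition_matrix_continuous_initial:
  fixes A :: "real \<Rightarrow> real^'n^'n"
  assumes A: "continuous_on {0..} A" and R: "state_transition_matrix A R" and a: "0 \<le> a"
  shows "continuous_on {a..b} (\<lambda>s. R a s)"
proof -
  have det: "det (R s a) \<noteq> 0" if "s \<in> {a..b}" for s
    using transition_matrix_inverse[OF A R a, of s] that
    by (metis atLeastAtMost_iff invertible_det_nz invertible_right_inverse)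
  \<comment> \<open>This form covers the Cramer numerators, where one column is replaced by a
    constant vector; \<open>P = False\<close> covers the denominator.\<close>
  have entry: "continuous_on {a..b} (\<lambda>s. if P then q else R s a $ i $ j)" for P q i j
    by (cases P) (auto intro!: continuous_on_component transition_matrix_continuous[OF R a a])
  have "continuous_on {a..b} (\<lambda>s. \<chi> i j. det (\<chi> i' j'. if j' = i then axis j 1 $ i' else R s a $ i' $ j')
                                 / det (R s a))"
    by (intro continuous_on_vec_lambda continuous_on_divide continuous_on_det)
       (use det entry entry[of False] in simp_all)
  moreover have "R a s = (\<chi> i j. det (\<chi> i' j'. if j' = i then axis j 1 $ i' else R s a $ i' $ j') / det (R s a))"
    if s: "s \<in> {a..b}" for s
  proof -
    have "R s a *v (R a s *v axis j 1) = axis j 1" for j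
      using transition_matrix_inverse[OF A R a, of s] s by (simp add: matrix_vector_mul_assoc)
    hence "R a s *v axis j 1 = (\<chi> k. det (\<chi> i' j'. if j' = k then axis j 1 $ i' else R s a $ i' $ j') / det (R s a))"
      for j using cramer[OF det[OF s]] by blast
    moreover have "R a s $ i $ j = (R a s *v axis j 1) $ i" for i j
      by (simp add: matrix_vector_mult_basis column_def)
    ultimately show ?thesis by (simp add: vec_eq_iff)
  qed
  ultimately show ?thesis by (subst continuous_on_cong[OF refl]) auto
qed

text \<open>The forcing is pulled back to time \<open>a\<close> and accumulated in \<open>z\<close>;
  pushing \<open>z\<close> forward by \<open>R t a\<close> gives \<open>\<psi>\<close>. The product
  rule shows that \<open>\<psi>\<close> satisfies the integral equation of \<open>x\<close>, so the
  two agree at \<open>b\<close>, and the composition law moves \<open>R b a\<close> under the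
  integral.\<close>

lemma variation_of_constants:
  fixes A :: "real \<Rightarrow> real^'n^'n" and x f :: "real \<Rightarrow> real^'n"
  assumes A: "continuous_on {0..} A" and R: "state_transition_matrix A R"
    and a: "0 \<le> a" and "a \<le> b"
    and x: "continuous_on {a..b} x" and f: "f absolutely_integrable_on {a..b}"
    and eq: "\<And>t. t \<in> {a..b} \<Longrightarrow> x t = x0 + integral {a..t} (\<lambda>s. A s *v x s + f s)"
  shows "(\<lambda>s. R b s *v f s) absolutely_integrable_on {a..b}"
    and "x b = R b a *v x0 + integral {a..b} (\<lambda>s. R b s *v f s)"
proof -
  interpret mv: bounded_bilinear "(*v) :: real^'n^'n \<Rightarrow> real^'n \<Rightarrow> real^'n"
    by (rule bounded_bilinear_matrix_vector_mult)
  have Ac: "continuous_on {a..b} A" using A a by (auto intro: continuous_on_subset)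
  have Rc: "continuous_on {a..b} (\<lambda>s. R s a)" by (rule transition_matrix_continuous[OF R a a])
  define y where "y s = R a s *v f s" for s
  define z where "z t = x0 + integral {a..t} y" for t
  have y: "y absolutely_integrable_on {a..b}"
    unfolding y_def
    by (rule absolutely_integrable_continuous_product[OF bounded_bilinear_matrix_vector_mult
          transition_matrix_continuous_initial[OF A R a] f])
  have yi: "y integrable_on {a..b}" using y set_lebesgue_integral_eq_integral(1) by blast
  have zc: "continuous_on {a..b} z"
    unfolding z_def by (intro continuous_intros indefinite_integral_continuous_1 yi)
  have fi: "f integrable_on {a..b}" using f set_lebesgue_integral_eq_integral(1) by blast
  have undo: "R s a *v y s = f s" if "s \<in> {a..b}" for s
    using transition_matrix_inverse[OF A R a, of s] that by (simp add: y_def matrix_vector_mul_assoc)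
  have sub: "{a..t} \<subseteq> {a..b}" if "t \<in> {a..b}" for t using that by auto
  define \<psi> where "\<psi> t = R t a *v z t" for t
  have \<psi>c: "continuous_on {a..b} \<psi>"
    unfolding \<psi>_def by (intro mv.continuous_on Rc zc)
  have \<psi>_eq: "\<psi> t = x0 + integral {a..t} (\<lambda>s. A s *v \<psi> s + f s)" if t: "t \<in> {a..b}" for t
  proof -
    have "continuous_on {a..t} (\<lambda>s. A s ** R s a)"
      unfolding matrix_matrix_mult_def
      by (intro continuous_on_vec_lambda continuous_intros continuous_on_subset[OF Ac sub[OF t]]
            continuous_on_subset[OF Rc sub[OF t]])
    hence dR: "(\<lambda>s. A s ** R s a) absolutely_integrable_on {a..t}"
      by (rule absolutely_integrable_continuous_real)
    have R_eq: "R r a = R a a + integral {a..r} (\<lambda>s. A s ** R s a)" if "r \<in> {a..t}" for r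
    proof -
      have "((\<lambda>s. A s ** R s a) has_integral R r a - R a a) {a..r}"
        using that by (intro fundamental_theorem_of_calculus transition_matrix_derivative[OF R a a]) auto
      thus ?thesis by (simp add: integral_unique)
    qed
    have z_eq: "z r = z a + integral {a..r} y" for r by (simp add: z_def)
    have yt: "y absolutely_integrable_on {a..t}"
      using absolutely_integrable_on_subinterval[OF y sub[OF t]] .
    have "a \<le> t" using t by simp
    \<comment> \<open>The term in which \<open>z\<close> is differentiated returns \<open>f\<close>
      by \<open>undo\<close>, the other one is \<open>A s\<close> applied to
      \<open>\<psi> s\<close>.\<close>
    from integral_by_parts_absolutely_continuous[where Y = z, OF bounded_bilinear_matrix_vector_mult this dR yt R_eq z_eq]
    have "integral {a..t} (\<lambda>s. R s a *v y s + (A s ** R s a) *v z s)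
        = R t a *v z t - R a a *v z a" .
    moreover have "integral {a..t} (\<lambda>s. R s a *v y s + (A s ** R s a) *v z s)
        = integral {a..t} (\<lambda>s. A s *v \<psi> s + f s)"
      using t by (intro integral_cong) (auto simp: undo \<psi>_def matrix_vector_mul_assoc)
    moreover have "R a a *v z a = x0" using R a by (simp add: z_def state_transition_matrix_def)
    ultimately show ?thesis by (simp add: \<psi>_def algebra_simps)
  qed
  \<comment> \<open>The forcing cancels in the difference, which leaves the homogeneous equation
    with initial value 0.\<close>
  have "x b - \<psi> b = 0"
  proof (rule linear_integral_equation_unique[OF \<open>a \<le> b\<close> Ac])
    show "continuous_on {a..b} (\<lambda>t. x t - \<psi> t)" by (intro continuous_intros x \<psi>c)
    fix t assume t: "t \<in> {a..b}"
    have int: "(\<lambda>s. A s *v v s + f s) integrable_on {a..t}" if "continuous_on {a..b} v" for v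
    proof (rule integrable_on_subinterval[OF _ sub[OF t]])
      show "(\<lambda>s. A s *v v s + f s) integrable_on {a..b}"
        by (intro integrable_add fi integrable_continuous_real mv.continuous_on Ac that)
    qed
    have "x t - \<psi> t = integral {a..t} (\<lambda>s. A s *v x s + f s) - integral {a..t} (\<lambda>s. A s *v \<psi> s + f s)"
      using eq[OF t] \<psi>_eq[OF t] by simp
    also have "\<dots> = integral {a..t} (\<lambda>s. A s *v x s + f s - (A s *v \<psi> s + f s))"
      by (intro Henstock_Kurzweil_Integration.integral_diff[symmetric] int x \<psi>c)
    finally show "x t - \<psi> t = integral {a..t} (\<lambda>s. A s *v (x s - \<psi> s))"
      by (simp add: matrix_vector_mult_diff_distrib)
  qed
  hence xb: "x b = R b a *v x0 + R b a *v integral {a..b} y"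
    by (simp add: \<psi>_def z_def matrix_vector_right_distrib)
  have comp: "R b a *v y s = R b s *v f s" if "s \<in> {a..b}" for s
    using transition_matrix_compose[OF A R a \<open>a \<le> b\<close>, of s "f s"] a that by (simp add: y_def)
  have "(\<lambda>s. R b a *v y s) absolutely_integrable_on {a..b}"
    using absolutely_integrable_linear[OF y mv.bounded_linear_right[of "R b a"]] by (simp add: o_def)
  thus "(\<lambda>s. R b s *v f s) absolutely_integrable_on {a..b}"
    by (rule absolutely_integrable_spike[where S = "{}"]) (use comp in auto)
  have "R b a *v integral {a..b} y = integral {a..b} (\<lambda>s. R b a *v y s)"
    using integral_linear[OF yi mv.bounded_linear_right[of "R b a"]] by (simp add: o_def)
  also have "\<dots> = integral {a..b} (\<lambda>s. R b s *v f s)"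
    using comp by (intro integral_cong) auto
  finally show "x b = R b a *v x0 + integral {a..b} (\<lambda>s. R b s *v f s)"
    using xb by simp
qed

section \<open>Linear growth of the integral of \<open>\<phi>\<close>\<close>

lemma measurable_lebesgue_on_Icc:
  assumes "f \<in> borel_measurable (lebesgue_on {0..})" "0 \<le> a"
  shows "f \<in> borel_measurable (lebesgue_on {a..b::real})"
  by (rule measurable_restrict_mono[OF assms(1)]) (use assms(2) in auto)

text \<open>The rate \<open>e\<close> is arbitrary; its price is a constant \<open>K\<close> that
  depends on \<open>e\<close> but not on the interval, because the part of \<open>\<phi>\<close>
  above \<open>e\<close> is controlled by an integral over the whole half-line.\<close>

lemma Lp_integral_bound_finite:
  assumes p: "1 \<le> p" "p \<noteq> \<infinity>" and \<phi>: "in_Lp p \<phi>" and nonneg: "\<And>t. 0 \<le> t \<Longrightarrow> 0 \<le> \<phi> t" and e: "e > 0"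
  shows "\<exists>K. \<forall>a b. 0 \<le> a \<longrightarrow> a \<le> b \<longrightarrow>
           \<phi> absolutely_integrable_on {a..b} \<and> integral {a..b} \<phi> \<le> e * (b - a) + K"
proof -
  define q where "q = real_of_ereal p"
  have q: "1 \<le> q" using p by (cases p) (auto simp: q_def)
  define h where "h t = \<bar>\<phi> t\<bar> powr q" for t
  have \<phi>m: "\<phi> \<in> borel_measurable (lebesgue_on {0..})" and "integrable (lebesgue_on {0..}) h"
    using \<phi> p by (auto simp: in_Lp_def h_def[abs_def] q_def)
  hence hi: "h integrable_on {0..}" by (intro integrable_on_lebesgue_on) auto
  define C where "C = e powr (1 - q)"
  have C: "C \<ge> 0" by (simp add: C_def)
  (* where \<phi> exceeds e it is at most \<phi>^q e^(1-q), so Hoelder's inequality is not needed *)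
  have le: "\<phi> t \<le> e + C * h t" if "0 \<le> t" for t
  proof (cases "\<phi> t \<le> e")
    case True
    thus ?thesis using C by (simp add: h_def add_increasing2)
  next
    case False
    hence "\<phi> t powr (1 - q) \<le> C" unfolding C_def using e q by (intro powr_mono2') auto
    hence "\<phi> t powr (1 - q) * \<phi> t powr q \<le> C * h t"
      unfolding h_def using nonneg[OF that] C by (intro mult_mono) auto
    moreover have "\<phi> t powr (1 - q) * \<phi> t powr q = \<phi> t" 
      using False e by (simp add: powr_add[symmetric])
    ultimately show ?thesis using e by simp
  qed
  have "\<phi> absolutely_integrable_on {a..b} \<and> integral {a..b} \<phi> \<le> e * (b - a) + C * integral {0..} h"
    if ab: "0 \<le> a" "a \<le> b" for a b
  proof
    have h_ab: "h integrable_on {a..b}" using ab by (intro integrable_on_subinterval[OF hi]) auto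
    hence bnd: "(\<lambda>t. e + C * h t) integrable_on {a..b}"
      by (intro integrable_add integrable_on_mult_right) auto
    show abs: "\<phi> absolutely_integrable_on {a..b}"
      by (rule measurable_bounded_by_integrable_imp_absolutely_integrable[OF _ _ bnd])
         (use ab le nonneg measurable_lebesgue_on_Icc[OF \<phi>m] in auto)
    have "integral {a..b} \<phi> \<le> integral {a..b} (\<lambda>t. e + C * h t)"
      using set_lebesgue_integral_eq_integral(1)[OF abs] bnd ab le by (intro integral_le) auto
    also have "\<dots> = e * (b - a) + C * integral {a..b} h"
      using integrable_on_mult_right[OF h_ab, of C] ab
      by (subst Henstock_Kurzweil_Integration.integral_add) auto
    also have "\<dots> \<le> e * (b - a) + C * integral {0..} h"
      using C h_ab hi ab by (intro add_left_mono mult_left_mono integral_subset_le) (auto simp: h_def)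
    finally show "integral {a..b} \<phi> \<le> e * (b - a) + C * integral {0..} h" .
  qed
  thus ?thesis by blast
qed

text \<open>Off a null set \<open>\<phi>\<close> coincides with \<open>min (\<phi> t) e\<close>,
  which is bounded; neither integrability nor the integral notices the change. Here \<open>e\<close>
  cannot be chosen below the norm.\<close>

lemma Linf_integral_bound:
  assumes \<phi>: "in_Lp \<infinity> \<phi>" and nonneg: "\<And>t. 0 \<le> t \<Longrightarrow> 0 \<le> \<phi> t" and e: "Lp_norm \<infinity> \<phi> \<le> e" "0 \<le> e"
    and ab: "0 \<le> a" "a \<le> b"
  shows "\<phi> absolutely_integrable_on {a..b} \<and> integral {a..b} \<phi> \<le> e * (b - a)"
proof
  define M where "M = esssup (lebesgue_on {0..}) (\<lambda>t. ereal \<bar>\<phi> t\<bar>)"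
  have \<phi>m: "\<phi> \<in> borel_measurable (lebesgue_on {0..})" and M: "M < \<infinity>" "real_of_ereal M \<le> e"
    using \<phi> e by (auto simp: in_Lp_def Lp_norm_def M_def)
  have "AE t in lebesgue_on {0..}. ereal \<bar>\<phi> t\<bar> \<le> M" unfolding M_def by (rule esssup_AE)
  hence "AE t in lebesgue_on {0..}. \<phi> t \<le> e"
  proof eventually_elim
    case (elim t)
    \<comment> \<open>\<open>real_of_ereal\<close> sends both infinities to 0, so they must be
      excluded: \<open>\<infinity>\<close> by \<open>in_Lp\<close>, and the negative one because
      \<open>M\<close> dominates an absolute value.\<close>
    thus ?case using M by (cases M) auto
  qed
  hence "AE t in lebesgue. t \<in> {0..} \<longrightarrow> \<phi> t \<le> e"
    by (subst (asm) AE_restrict_space_iff) auto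
  then obtain Z where Z: "Z \<in> null_sets lebesgue" "{t. \<not> (t \<in> {0..} \<longrightarrow> \<phi> t \<le> e)} \<subseteq> Z"
    by (auto simp: eventually_ae_filter)
  have negl: "negligible Z" using Z(1) by (simp add: negligible_iff_null_sets)
  have eq: "min (\<phi> t) e = \<phi> t" if "t \<in> {a..b} - Z" for t
  proof -
    have "t \<in> {0..}" "t \<notin> Z" using that ab by auto
    hence "\<phi> t \<le> e" using Z(2) by blast
    thus ?thesis by simp
  qed
  have \<psi>: "(\<lambda>t. min (\<phi> t) e) absolutely_integrable_on {a..b}"
  proof (rule measurable_bounded_by_integrable_imp_absolutely_integrable)
    show "(\<lambda>t. min (\<phi> t) e) \<in> borel_measurable (lebesgue_on {a..b})"
      using measurable_lebesgue_on_Icc[OF \<phi>m ab(1)] by (intro borel_measurable_min) auto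
    show "(\<lambda>t. e) integrable_on {a..b}" by (rule integrable_const_ivl)
    show "norm (min (\<phi> t) e) \<le> e" if "t \<in> {a..b}" for t using nonneg[of t] that ab e by auto
  qed auto
  thus "\<phi> absolutely_integrable_on {a..b}"
    by (rule absolutely_integrable_spike[OF _ negl]) (use eq in auto)
  have "integral {a..b} \<phi> = integral {a..b} (\<lambda>t. min (\<phi> t) e)"
    by (rule integral_spike[OF negl]) (use eq in auto)
  also have "\<dots> \<le> integral {a..b} (\<lambda>t. e)"
    using \<psi> by (intro integral_le set_lebesgue_integral_eq_integral(1)) auto
  also have "\<dots> = e * (b - a)" using ab by simp
  finally show "integral {a..b} \<phi> \<le> e * (b - a)" .
qed

lemma Lp_integral_bound:
  assumes "1 \<le> p" "in_Lp p \<phi>" "\<And>t. 0 \<le> t \<Longrightarrow> 0 \<le> \<phi> t" "e > 0" "p = \<infinity> \<Longrightarrow> Lp_norm p \<phi> \<le> e"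
  shows "\<exists>K. \<forall>a b. 0 \<le> a \<longrightarrow> a \<le> b \<longrightarrow>
           \<phi> absolutely_integrable_on {a..b} \<and> integral {a..b} \<phi> \<le> e * (b - a) + K"
proof (cases "p = \<infinity>")
  case True
  thus ?thesis using Linf_integral_bound[of \<phi> e] assms by (intro exI[of _ 0]) auto
next
  case False
  thus ?thesis using assms by (intro Lp_integral_bound_finite)
qed

section \<open>Linear bounds for \<open>\<omega>\<close> near 0\<close>

lemma le_linear_near_0:
  fixes \<omega> :: "real \<Rightarrow> real"
  assumes "(\<omega> has_real_derivative d) (at 0 within {0..})" "\<omega> 0 = 0" "d < L"
  obtains \<delta> where "\<delta> > 0" "\<And>s. 0 \<le> s \<Longrightarrow> s \<le> \<delta> \<Longrightarrow> \<omega> s \<le> L * s"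
proof -
  have "((\<lambda>s. \<omega> s / s) \<longlongrightarrow> d) (at 0 within {0..})"
    using assms(1,2) by (simp add: has_field_derivative_iff)
  hence "\<forall>\<^sub>F s in at 0 within {0..}. \<omega> s / s < L" using assms(3) by (rule order_tendstoD)
  then obtain d' where d': "d' > 0" "\<And>s. s \<in> {0..} \<Longrightarrow> s \<noteq> 0 \<Longrightarrow> dist s 0 < d' \<Longrightarrow> \<omega> s / s < L"
    unfolding eventually_at by blast
  have "\<omega> s \<le> L * s" if "0 \<le> s" "s \<le> d' / 2" for s
  proof (cases "s = 0")
    case False
    hence "\<omega> s / s < L" using that d'(1) by (intro d'(2)) auto
    thus ?thesis using False that by (simp add: field_simps)
  qed (simp add: assms)
  thus ?thesis using d'(1) by (intro that[of "d' / 2"]) auto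
qed

text \<open>The mean value theorem on \<open>{0..s}\<close>. It serves the case where the slope has
  to be the very supremum that occurs in the threshold; the first conclusion, taken at 0, makes that
  supremum positive. Continuity of \<open>\<omega>'\<close> on a compact interval makes it a genuine
  upper bound.\<close>

lemma le_Sup_deriv_mult:
  fixes \<omega> \<omega>' :: "real \<Rightarrow> real"
  assumes deriv: "\<And>s. 0 \<le> s \<Longrightarrow> (\<omega> has_real_derivative \<omega>' s) (at s within {0..})"
    and cont: "continuous_on {0..} \<omega>'" and "\<omega> 0 = 0" and s: "0 \<le> s" "s \<le> \<delta>"
  shows "\<omega>' s \<le> (SUP s\<in>{0..\<delta>}. \<bar>\<omega>' s\<bar>)" "\<omega> s \<le> (SUP s\<in>{0..\<delta>}. \<bar>\<omega>' s\<bar>) * s"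
proof -
  have "continuous_on {0..\<delta>} (\<lambda>s. \<bar>\<omega>' s\<bar>)"
    by (intro continuous_intros continuous_on_subset[OF cont]) auto
  hence "bdd_above ((\<lambda>s. \<bar>\<omega>' s\<bar>) ` {0..\<delta>})"
    by (intro bounded_imp_bdd_above compact_imp_bounded compact_continuous_image) auto
  hence up: "\<omega>' r \<le> (SUP s\<in>{0..\<delta>}. \<bar>\<omega>' s\<bar>)" if "r \<in> {0..\<delta>}" for r
    using cSUP_upper[of r "{0..\<delta>}" "\<lambda>s. \<bar>\<omega>' s\<bar>"] that by force
  thus "\<omega>' s \<le> (SUP s\<in>{0..\<delta>}. \<bar>\<omega>' s\<bar>)" using s by simp
  show "\<omega> s \<le> (SUP s\<in>{0..\<delta>}. \<bar>\<omega>' s\<bar>) * s"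
  proof (cases "s = 0")
    case False
    have "\<exists>r\<in>{0<..<s}. \<omega> s - \<omega> 0 = (*) (\<omega>' r) (s - 0)"
    proof (rule mvt_simple)
      show "(\<omega> has_derivative (*) (\<omega>' r)) (at r within {0..s})" if "0 \<le> r" "r \<le> s" for r
        using has_field_derivative_subset[OF deriv[OF that(1)], of "{0..s}"]
        by (auto simp: has_field_derivative_def)
    qed (use False s in auto)
    then obtain r where "r \<in> {0<..<s}" "\<omega> s = \<omega>' r * s" using \<open>\<omega> 0 = 0\<close> by auto
    thus ?thesis using up[of r] s by (auto intro: mult_right_mono)
  qed (simp add: \<open>\<omega> 0 = 0\<close>)
qed

section \<open>Decay of small solutions and global existence\<close>

lemma Icc_subset_time_interval:
  assumes "t \<in> time_interval t0 T"
  shows "{t0..t} \<subseteq> time_interval t0 T"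
proof
  fix s assume s: "s \<in> {t0..t}"
  hence "ereal s \<le> ereal t" by simp
  also have "\<dots> < T" using assms by (simp add: time_interval_def)
  finally show "s \<in> time_interval t0 T" using s by (simp add: time_interval_def)
qed

text \<open>The weight \<open>exp (\<gamma> * (s - t0))\<close> turns the convolution kernel into a
  factor depending on \<open>r\<close> alone, which Gronwall's inequality requires. Smallness is
  assumed only up to the time considered and is not strict, so the estimate remains usable at a
  first exit time.\<close>

lemma perturbed_solution_decay:
  fixes A :: "real \<Rightarrow> real^'n^'n" and N :: "real^'n \<Rightarrow> real"
  assumes N: "is_norm N" and A: "continuous_on {0..} A" and R: "state_transition_matrix A R"
    and c: "c > 0" and L: "L \<ge> 0"
    and R_bound: "\<And>t t0. 0 \<le> t0 \<Longrightarrow> t0 \<le> t \<Longrightarrow> induced_norm N (R t t0) \<le> c * exp (- \<gamma> * (t - t0))"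
    and \<phi>_nonneg: "\<And>t. 0 \<le> t \<Longrightarrow> 0 \<le> \<phi> t"
    and \<phi>_int: "\<And>a b. 0 \<le> a \<Longrightarrow> a \<le> b \<Longrightarrow> \<phi> absolutely_integrable_on {a..b}"
    and g_bound: "\<And>t x. 0 \<le> t \<Longrightarrow> N (g t x) \<le> \<phi> t * \<omega> (N x)"
    and \<omega>: "\<And>s. 0 \<le> s \<Longrightarrow> s \<le> \<delta> \<Longrightarrow> \<omega> s \<le> L * s"
    and sol: "is_solution A g t0 x0 T x" and t0: "0 \<le> t0" and t: "t \<in> time_interval t0 T"
    and small: "\<And>s. s \<in> {t0..t} \<Longrightarrow> N (x s) \<le> \<delta>"
  shows "N (x t) \<le> c * N x0 * exp (c * L * integral {t0..t} \<phi> - \<gamma> * (t - t0))"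
proof -
  have Npos: "0 \<le> N y" for y using N by (simp add: is_norm_def)
  have "t0 \<le> t" using t by (simp add: time_interval_def)
  have sub: "{t0..t} \<subseteq> time_interval t0 T"
    using t by (rule Icc_subset_time_interval)
  define f where "f s = g s (x s)" for s
  have xc: "continuous_on {t0..t} x" and f: "f absolutely_integrable_on {t0..t}"
    and eq: "\<And>r. r \<in> {t0..t} \<Longrightarrow> x r = x0 + integral {t0..r} (\<lambda>s. A s *v x s + f s)"
    using sol t sub continuous_on_subset[OF _ sub] by (auto simp: is_solution_def f_def[abs_def])
  define k where "k s = c * L * \<phi> s" for s
  define u where "u s = exp (\<gamma> * (s - t0)) * N (x s)" for s
  have Nxc: "continuous_on {t0..t} (\<lambda>s. N (x s))"
    by (rule continuous_on_compose2[OF is_norm_continuous_on[OF N, of UNIV] xc]) auto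
  have uc: "continuous_on {t0..t} u" unfolding u_def by (intro continuous_intros Nxc)
  have k: "k absolutely_integrable_on {t0..t}"
    unfolding k_def by (intro set_integrable_mult_right \<phi>_int t0 \<open>t0 \<le> t\<close>)
  have ku: "(\<lambda>s. k s * u s) integrable_on {t0..t}"
    using absolutely_integrable_continuous_product[OF bounded_bilinear_mult uc k]
    by (simp add: mult.commute set_lebesgue_integral_eq_integral(1))
  have "u t \<le> (c * N x0) * exp (integral {t0..t} k)"
  proof (rule gronwall_integrable[OF \<open>t0 \<le> t\<close> k _ uc])
    fix r assume r: "r \<in> {t0..t}"
    show "0 \<le> k r" using r t0 c L \<phi>_nonneg by (simp add: k_def)
    show "0 \<le> u r" using Npos by (simp add: u_def)
    have r': "t0 \<le> r" "r \<le> t" "{t0..r} \<subseteq> {t0..t}" using r by auto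
    have fr: "f absolutely_integrable_on {t0..r}"
      using absolutely_integrable_on_subinterval[OF f r'(3)] .
    note voc = variation_of_constants[OF A R t0 r'(1) continuous_on_subset[OF xc r'(3)] fr eq]
    have abs: "(\<lambda>s. R r s *v f s) absolutely_integrable_on {t0..r}" using r' by (intro voc) auto
    have xr: "x r = R r t0 *v x0 + integral {t0..r} (\<lambda>s. R r s *v f s)" using r' by (intro voc) auto
    have decay: "N (R r s *v y) \<le> c * exp (- \<gamma> * (r - s)) * N y" if "s \<in> {t0..r}" for s y
    proof -
      have "N (R r s *v y) \<le> induced_norm N (R r s) * N y" by (rule induced_norm_bound[OF N])
      also have "\<dots> \<le> c * exp (- \<gamma> * (r - s)) * N y"
        using that t0 by (intro mult_right_mono R_bound Npos) auto
      finally show ?thesis .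
    qed
    have "N (integral {t0..r} (\<lambda>s. R r s *v f s)) \<le> integral {t0..r} (\<lambda>s. N (R r s *v f s))"
      by (rule is_norm_integral_le[OF N abs])
    also have "\<dots> \<le> integral {t0..r} (\<lambda>s. exp (- \<gamma> * (r - t0)) * (k s * u s))"
    proof (rule integral_le)
      show "(\<lambda>s. N (R r s *v f s)) integrable_on {t0..r}"
        using is_norm_absolutely_integrable[OF N abs] set_lebesgue_integral_eq_integral(1) by blast
      show "(\<lambda>s. exp (- \<gamma> * (r - t0)) * (k s * u s)) integrable_on {t0..r}"
        by (intro integrable_on_mult_right integrable_on_subinterval[OF ku r'(3)])
      fix s assume s: "s \<in> {t0..r}"
      have "N (f s) \<le> \<phi> s * \<omega> (N (x s))" unfolding f_def using s t0 by (intro g_bound) auto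
      also have "\<dots> \<le> \<phi> s * (L * N (x s))"
        using s t0 r' by (intro mult_left_mono \<omega> \<phi>_nonneg Npos small) auto
      finally have le: "c * exp (- \<gamma> * (r - s)) * N (f s) \<le> c * exp (- \<gamma> * (r - s)) * (\<phi> s * (L * N (x s)))"
        using c by (intro mult_left_mono) auto
      \<comment> \<open>The first factor leaves the integral, the second is absorbed into
        \<open>u s\<close>.\<close>
      have ex: "exp (- \<gamma> * (r - s)) = exp (- \<gamma> * (r - t0)) * exp (\<gamma> * (s - t0))"
        by (simp add: exp_add[symmetric] algebra_simps)
      show "N (R r s *v f s) \<le> exp (- \<gamma> * (r - t0)) * (k s * u s)"
        using order_trans[OF decay[OF s] le] by (simp only: ex k_def u_def mult_ac)
    qed
    also have "\<dots> = exp (- \<gamma> * (r - t0)) * integral {t0..r} (\<lambda>s. k s * u s)" by simp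
    finally have int: "N (integral {t0..r} (\<lambda>s. R r s *v f s)) \<le> \<dots>" .
    have "N (x r) \<le> N (R r t0 *v x0) + N (integral {t0..r} (\<lambda>s. R r s *v f s))"
      unfolding xr using N by (simp add: is_norm_def)
    also have "\<dots> \<le> c * exp (- \<gamma> * (r - t0)) * N x0
        + exp (- \<gamma> * (r - t0)) * integral {t0..r} (\<lambda>s. k s * u s)"
      using decay[of t0 x0] int r' by (intro add_mono) auto
    finally have "u r \<le> exp (\<gamma> * (r - t0)) * (exp (- \<gamma> * (r - t0)) *
        (c * N x0 + integral {t0..r} (\<lambda>s. k s * u s)))"
      unfolding u_def by (intro mult_left_mono) (auto simp: algebra_simps)
    also have "\<dots> = c * N x0 + integral {t0..r} (\<lambda>s. k s * u s)"
      by (simp add: mult.assoc[symmetric] exp_add[symmetric])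
    finally show "u r \<le> c * N x0 + integral {t0..r} (\<lambda>s. k s * u s)" .
  qed
  moreover have "integral {t0..t} k = c * L * integral {t0..t} \<phi>" by (simp add: k_def[abs_def])
  ultimately have "exp (- \<gamma> * (t - t0)) * u t
      \<le> exp (- \<gamma> * (t - t0)) * ((c * N x0) * exp (c * L * integral {t0..t} \<phi>))"
    by (intro mult_left_mono) auto
  moreover have "exp (- \<gamma> * (t - t0)) * u t = N (x t)"
    by (simp add: u_def mult.assoc[symmetric] exp_add[symmetric])
  moreover have "exp (c * L * integral {t0..t} \<phi> - \<gamma> * (t - t0))
      = exp (- \<gamma> * (t - t0)) * exp (c * L * integral {t0..t} \<phi>)"
    by (simp add: exp_add[symmetric])
  ultimately show ?thesis by (simp only: mult_ac)
qed

text \<open>The level set of \<open>\<delta>\<close> is compact and nonempty, and \<open>s\<close>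
  is its least element. A value above \<open>\<delta>\<close> before \<open>s\<close> would, by the
  intermediate value theorem, produce an earlier point of the level set.\<close>

lemma first_crossing:
  fixes v :: "real \<Rightarrow> real"
  assumes v: "continuous_on {a..b} v" and "a \<le> b" "v a < \<delta>" "\<delta> \<le> v b"
  obtains s where "s \<in> {a..b}" "v s = \<delta>" "\<And>r. r \<in> {a..s} \<Longrightarrow> v r \<le> \<delta>"
proof -
  define S where "S = {s \<in> {a..b}. v s = \<delta>}"
  have ivt: "\<exists>s\<ge>a. s \<le> r \<and> v s = \<delta>" if "a \<le> r" "r \<le> b" "\<delta> \<le> v r" for r
    using that \<open>v a < \<delta>\<close> by (intro IVT' continuous_on_subset[OF v]) auto
  have "S \<noteq> {}" using ivt[of b] assms by (auto simp: S_def)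
  moreover have "compact S"
  proof -
    have "closed S" unfolding S_def
      using continuous_closed_preimage_constant[OF v, of \<delta>] by (simp add: Collect_conj_eq)
    moreover have "bounded S" by (rule bounded_subset[of "{a..b}"]) (auto simp: S_def)
    ultimately show ?thesis by (simp add: compact_eq_bounded_closed)
  qed
  ultimately obtain s where s: "s \<in> S" "\<And>r. r \<in> S \<Longrightarrow> s \<le> r"
    using compact_attains_inf[of S] by metis
  have "v r \<le> \<delta>" if r: "r \<in> {a..s}" for r
  proof (rule ccontr)
    assume "\<not> v r \<le> \<delta>"
    moreover have rb: "a \<le> r" "r \<le> b" using r s(1) by (auto simp: S_def)
    ultimately obtain r' where r': "a \<le> r'" "r' \<le> r" "v r' = \<delta>" using ivt[of r] by auto
    hence "s \<le> r'" using rb by (intro s(2)) (auto simp: S_def)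
    hence "r' = r" using r r' by simp
    thus False using r' \<open>\<not> v r \<le> \<delta>\<close> by simp
  qed
  thus ?thesis using that s(1) by (auto simp: S_def)
qed

lemma perturbed_uniformly_exponentially_stable:
  fixes A :: "real \<Rightarrow> real^'n^'n" and N :: "real^'n \<Rightarrow> real"
  assumes N: "is_norm N" and A: "continuous_on {0..} A" and R: "state_transition_matrix A R"
    and g_cont: "continuation_property A g"
    and c: "c > 0" and L: "L > 0" and \<delta>: "\<delta> > 0"
    and R_bound: "\<And>t t0. 0 \<le> t0 \<Longrightarrow> t0 \<le> t \<Longrightarrow> induced_norm N (R t t0) \<le> c * exp (- \<gamma> * (t - t0))"
    and \<phi>_nonneg: "\<And>t. 0 \<le> t \<Longrightarrow> 0 \<le> \<phi> t"
    and \<phi>_int: "\<And>a b. 0 \<le> a \<Longrightarrow> a \<le> b \<Longrightarrow> \<phi> absolutely_integrable_on {a..b}"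
    and \<phi>_bound: "\<And>a b. 0 \<le> a \<Longrightarrow> a \<le> b \<Longrightarrow> integral {a..b} \<phi> \<le> e * (b - a) + K"
    and gap: "c * L * e < \<gamma>"
    and g_bound: "\<And>t x. 0 \<le> t \<Longrightarrow> N (g t x) \<le> \<phi> t * \<omega> (N x)"
    and \<omega>: "\<And>s. 0 \<le> s \<Longrightarrow> s \<le> \<delta> \<Longrightarrow> \<omega> s \<le> L * s"
  shows "uniformly_exponentially_stable N A g"
proof -
  define C where "C = c * exp (c * L * K)"
  define \<mu> where "\<mu> = \<gamma> - c * L * e"
  \<comment> \<open>With this radius \<open>(C + 1) * N x0 \<le> \<delta> / 2\<close>, so the
    solution starts inside the ball and the bound \<open>C * N x0\<close> also stays strictly below
    \<open>\<delta>\<close>.\<close>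
  define \<delta>0 where "\<delta>0 = \<delta> / (2 * (C + 1))"
  have Npos: "0 \<le> N y" for y using N by (simp add: is_norm_def)
  have C: "C > 0" and \<mu>: "\<mu> > 0" using c gap by (auto simp: C_def \<mu>_def)
  hence \<delta>0: "\<delta>0 > 0" "(C + 1) * \<delta>0 = \<delta> / 2" using \<delta> by (auto simp: \<delta>0_def field_simps)
  have decay: "N (x t) \<le> C * N x0 * exp (- \<mu> * (t - t0))"
    if sol: "is_solution A g t0 x0 T x" and t0: "0 \<le> t0" and t: "t \<in> time_interval t0 T"
      and small: "\<And>s. s \<in> {t0..t} \<Longrightarrow> N (x s) \<le> \<delta>" for t0 x0 T x t
  proof -
    have "t0 \<le> t" using t by (simp add: time_interval_def)
    have "N (x t) \<le> c * N x0 * exp (c * L * integral {t0..t} \<phi> - \<gamma> * (t - t0))"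
      using perturbed_solution_decay[OF N A R c _ R_bound \<phi>_nonneg \<phi>_int g_bound \<omega> sol t0 t small] L
      by auto
    also have "\<dots> \<le> c * N x0 * exp (c * L * (e * (t - t0) + K) - \<gamma> * (t - t0))"
      using \<phi>_bound[OF t0 \<open>t0 \<le> t\<close>] c L Npos by (intro mult_left_mono) auto
    also have "c * L * (e * (t - t0) + K) - \<gamma> * (t - t0) = c * L * K + - \<mu> * (t - t0)"
      by (simp add: \<mu>_def algebra_simps)
    finally show ?thesis by (simp only: C_def exp_add mult_ac)
  qed
  have main: "T = \<infinity> \<and> (\<forall>t\<ge>t0. N (x t) \<le> C * N x0 * exp (- \<mu> * (t - t0)))"
    if t0: "0 \<le> t0" and x0: "N x0 \<le> \<delta>0" and nc: "noncontinuable_solution A g t0 x0 T x" for t0 x0 T x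
  proof -
    have sol: "is_solution A g t0 x0 T x" using nc by (simp add: noncontinuable_solution_def)
    have CN: "C * N x0 + N x0 \<le> \<delta> / 2"
      using mult_left_mono[OF x0, of "C + 1"] C \<delta>0 by (simp add: algebra_simps)
    have "t0 \<in> time_interval t0 T" using sol by (simp add: is_solution_def time_interval_def)
    hence "x t0 = x0" using sol by (auto simp: is_solution_def)
    hence start: "N (x t0) < \<delta>" using CN C \<delta> Npos[of x0] by (smt (verit) field_sum_of_halves mult_nonneg_nonneg)
    have inside: "N (x t) < \<delta>" if t: "t \<in> time_interval t0 T" for t
    proof (rule ccontr)
      assume "\<not> N (x t) < \<delta>"
      have sub: "{t0..t} \<subseteq> time_interval t0 T"
        using t by (rule Icc_subset_time_interval)
      hence "continuous_on {t0..t} x" using sol by (auto simp: is_solution_def intro: continuous_on_subset)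
      hence "continuous_on {t0..t} (\<lambda>s. N (x s))"
        by (rule continuous_on_compose2[OF is_norm_continuous_on[OF N, of UNIV]]) auto
      moreover have "t0 \<le> t" using t by (simp add: time_interval_def)
      ultimately obtain s where s: "s \<in> {t0..t}" "N (x s) = \<delta>" "\<And>r. r \<in> {t0..s} \<Longrightarrow> N (x r) \<le> \<delta>"
        using first_crossing[of t0 t "\<lambda>s. N (x s)" \<delta>] start \<open>\<not> N (x t) < \<delta>\<close> by (metis not_less)
      \<comment> \<open>Up to the crossing time \<open>s\<close> the decay estimate is available,
        and at \<open>s\<close> it contradicts \<open>C * N x0 \<le> \<delta> / 2\<close>.\<close>
      have "\<delta> \<le> C * N x0 * exp (- \<mu> * (s - t0))"
        using decay[OF sol t0 _ s(3)] s(1,2) sub by auto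
      also have "\<dots> \<le> C * N x0 * 1"
        using C \<mu> Npos s(1) by (intro mult_left_mono) (auto simp: mult_nonneg_nonneg)
      finally show False using CN \<delta> Npos[of x0] by simp
    qed
    have "T = \<infinity>"
    proof (rule ccontr)
      assume "T \<noteq> \<infinity>"
      hence "\<not> bounded (x ` time_interval t0 T)"
        using g_cont t0 nc unfolding continuation_property_def by auto
      moreover obtain m where m: "m > 0" "\<And>y. m * norm y \<le> N y" using is_norm_lower_bound[OF N] by blast
      have "norm (x t) \<le> \<delta> / m" if "t \<in> time_interval t0 T" for t
        using m(2)[of "x t"] inside[OF that] m(1) by (simp add: field_simps)
      hence "bounded (x ` time_interval t0 T)" unfolding bounded_iff by blast
      ultimately show False by blast
    qed
    moreover have "N (x t) \<le> C * N x0 * exp (- \<mu> * (t - t0))" if "t0 \<le> t" for t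
      using that \<open>T = \<infinity>\<close> inside by (intro decay[OF sol t0]) (auto simp: time_interval_def less_imp_le)
    ultimately show ?thesis by blast
  qed
  show ?thesis unfolding uniformly_exponentially_stable_def
    using \<delta>0(1) C \<mu> main by blast
qed

theorem theorem3p5:
  fixes N :: "real^'n \<Rightarrow> real"
    and A :: "real \<Rightarrow> real^'n^'n"
    and R :: "real \<Rightarrow> real \<Rightarrow> real^'n^'n"
    and g :: "real \<Rightarrow> real^'n \<Rightarrow> real^'n"
    and c \<gamma> :: real
    and p :: ereal
    and \<phi> \<omega> \<omega>' :: "real \<Rightarrow> real"
  assumes norm: "is_norm N"
    and A_cont: "continuous_on {0..} A"
    and g_zero: "\<And>t. 0 \<le> t \<Longrightarrow> g t 0 = 0"
    and g_cont: "continuation_property A g"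
    and uas: "uniformly_asymptotically_stable_linear N A"
    and R: "state_transition_matrix A R"
    and c_pos: "c > 0" and \<gamma>_pos: "\<gamma> > 0"
    and R_bound: "\<And>t t0. 0 \<le> t0 \<Longrightarrow> t0 \<le> t \<Longrightarrow>
                    induced_norm N (R t t0) \<le> c * exp (- \<gamma> * (t - t0))"
    and p: "1 \<le> p"
    and \<phi>_nonneg: "\<And>t. 0 \<le> t \<Longrightarrow> 0 \<le> \<phi> t"
    and \<phi>_Lp: "in_Lp p \<phi>"
    and \<omega>_nonneg: "\<And>s. 0 \<le> s \<Longrightarrow> 0 \<le> \<omega> s"
    and \<omega>_mono: "mono_on {0..} \<omega>"
    and \<omega>_deriv: "\<And>s. 0 \<le> s \<Longrightarrow> (\<omega> has_real_derivative \<omega>' s) (at s within {0..})"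
    and \<omega>_C1: "continuous_on {0..} \<omega>'"
    and \<omega>_zero: "\<omega> 0 = 0"
    and g_bound: "\<And>t x. 0 \<le> t \<Longrightarrow> N (g t x) \<le> \<phi> t * \<omega> (N x)"
    and alternatives:
      "\<omega>' 0 = 0 \<or>
       (\<omega>' 0 > 0 \<and>
         (p = 1 \<or>
          (1 < p \<and> (\<exists>\<delta>>0. Lp_norm p \<phi> < Lp_threshold p \<gamma> c (SUP s\<in>{0..\<delta>}. \<bar>\<omega>' s\<bar>)))))"
  shows "uniformly_exponentially_stable N A g"
proof -
  (* For p < \<infinity> the L^p bound gives an arbitrarily small linear growth rate e of the integral of \<phi>,
     so the threshold only matters for p = \<infinity>. *)
  have "\<exists>\<delta> L e. \<delta> > 0 \<and> L > 0 \<and> e > 0 \<and> c * L * e < \<gamma> \<and> (p = \<infinity> \<longrightarrow> Lp_norm p \<phi> \<le> e)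
      \<and> (\<forall>s. 0 \<le> s \<longrightarrow> s \<le> \<delta> \<longrightarrow> \<omega> s \<le> L * s)"
  proof -
    note near_0 = le_linear_near_0[OF \<omega>_deriv[of 0, OF order_refl] \<omega>_zero]
    consider "\<omega>' 0 = 0" | "\<omega>' 0 > 0" "p \<noteq> \<infinity>" | "\<omega>' 0 > 0" "p = \<infinity>"
      using alternatives by blast
    thus ?thesis
    proof cases
      case 1
      \<comment> \<open>Any positive number above the norm will do, since the slope \<open>L\<close>
        adapts to it: \<open>c * L * e\<close> becomes \<open>\<gamma> / 2\<close>.\<close>
      define e where "e = \<bar>Lp_norm p \<phi>\<bar> + 1"
      define L where "L = \<gamma> / (2 * c * e)"
      have e: "e > 0" "Lp_norm p \<phi> \<le> e" by (auto simp: e_def)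
      have "L > 0" using e \<gamma>_pos c_pos by (simp add: L_def)
      moreover have "c * L * e < \<gamma>" using e \<gamma>_pos c_pos by (simp add: L_def)
      moreover obtain \<delta> where "\<delta> > 0" "\<And>s. 0 \<le> s \<Longrightarrow> s \<le> \<delta> \<Longrightarrow> \<omega> s \<le> L * s"
        using near_0[of L] 1 \<open>L > 0\<close> by metis
      ultimately show ?thesis using e by blast
    next
      case 2
      \<comment> \<open>Any slope above the right derivative at 0 holds near 0; now the rate
        \<open>e\<close> adapts to \<open>L\<close>, again with
        \<open>c * L * e = \<gamma> / 2\<close>.\<close>
      define L where "L = \<omega>' 0 + 1"
      define e where "e = \<gamma> / (2 * c * L)"
      have "L > 0" using 2 by (simp add: L_def)
      moreover have "e > 0" using \<open>L > 0\<close> \<gamma>_pos c_pos by (simp add: e_def)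
      moreover have "c * L * e < \<gamma>" using \<open>L > 0\<close> \<gamma>_pos c_pos by (simp add: e_def)
      moreover obtain \<delta> where "\<delta> > 0" "\<And>s. 0 \<le> s \<Longrightarrow> s \<le> \<delta> \<Longrightarrow> \<omega> s \<le> L * s"
        using near_0[of L] by (auto simp: L_def)
      ultimately show ?thesis using 2 by blast
    next
      case 3
      then obtain \<delta> where \<delta>: "\<delta> > 0" "Lp_norm p \<phi> < Lp_threshold p \<gamma> c (SUP s\<in>{0..\<delta>}. \<bar>\<omega>' s\<bar>)"
        using alternatives by auto
      define L where "L = (SUP s\<in>{0..\<delta>}. \<bar>\<omega>' s\<bar>)"
      define b where "b = \<gamma> / (c * L)"
      \<comment> \<open>A point strictly between the norm and \<open>b\<close>, the value at which
        \<open>c * L * b = \<gamma>\<close>; the maximum with 0 makes \<open>e\<close>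
        positive.\<close>
      define e where "e = (max 0 (Lp_norm p \<phi>) + b) / 2"
      note sup = le_Sup_deriv_mult[OF \<omega>_deriv \<omega>_C1 \<omega>_zero, of _ \<delta>, folded L_def]
      have "L > 0" using sup(1)[of 0] \<delta>(1) 3(1) by simp
      hence pos: "b > 0" using \<gamma>_pos c_pos by (simp add: b_def)
      have lt: "Lp_norm p \<phi> < b" using \<delta>(2) 3(2) by (simp add: Lp_threshold_def L_def b_def)
      have e: "e > 0" "Lp_norm p \<phi> \<le> e" "e < b" using pos lt by (auto simp: e_def)
      have "c * L * e < c * L * b" using e \<open>L > 0\<close> c_pos by (intro mult_strict_left_mono) auto
      also have "\<dots> = \<gamma>" using \<open>L > 0\<close> c_pos by (simp add: b_def)
      finally show ?thesis using e \<delta>(1) \<open>L > 0\<close> sup(2) by blast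
    qed
  qed
  then obtain \<delta> L e where *: "\<delta> > 0" "L > 0" "e > 0" "c * L * e < \<gamma>" "p = \<infinity> \<Longrightarrow> Lp_norm p \<phi> \<le> e"
      "\<And>s. 0 \<le> s \<Longrightarrow> s \<le> \<delta> \<Longrightarrow> \<omega> s \<le> L * s"
    by blast
  have "\<exists>K. \<forall>a b. 0 \<le> a \<longrightarrow> a \<le> b \<longrightarrow>
      \<phi> absolutely_integrable_on {a..b} \<and> integral {a..b} \<phi> \<le> e * (b - a) + K"
    by (rule Lp_integral_bound[OF p \<phi>_Lp \<phi>_nonneg *(3,5)])
  then obtain K where "\<forall>a b. 0 \<le> a \<longrightarrow> a \<le> b \<longrightarrow>
      \<phi> absolutely_integrable_on {a..b} \<and> integral {a..b} \<phi> \<le> e * (b - a) + K"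
    by (elim exE)
  hence \<phi>_int: "\<phi> absolutely_integrable_on {a..b}" and \<phi>_bound: "integral {a..b} \<phi> \<le> e * (b - a) + K"
    if "0 \<le> a" "a \<le> b" for a b using that by simp_all
  show ?thesis
    by (rule perturbed_uniformly_exponentially_stable[OF norm A_cont R g_cont c_pos *(2,1) R_bound \<phi>_nonneg
          \<phi>_int \<phi>_bound *(4) g_bound *(6)])
qed

end
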